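(* Let $\boldsymbol{a}=(a_n)_{n\ge1}$ be the sequence of Schur parameters of a probability measure $\mu$ on $\mathbb{T}$ with infinite support and let $\boldsymbol{u}=(u_n)_{n\ge1}$ be a sequence in $\mathbb{T}$. Then $$K_{2n}(a_1,\dots,a_{n-1},u_n;z)\longrightarrow F_\mu(z)$$ uniformly on compact subsets of $\mathbb{C}\setminus\overline{\lim}_n\Sigma_n(\boldsymbol{a};\boldsymbol{u})$. Moreover, each $z\in\overline{\lim}_n\Sigma_n(\boldsymbol{a};\boldsymbol{u})\setminus\mathrm{supp}\,\mu$ (up to, at most, one point) has a neighbourhood $V$ for which there is an infinite set $\mathcal{I}\subset\mathbb{N}$ such that $K_{2n}(a_1,\dots,a_{n-1},u_n;w)\to F_\mu(w)$ as $n\to\infty$, $n\in\mathcal{I}$, uniformly for $w$ in compact subsets of $V$.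
   Context: $\mathbb{T}=\{z\in\mathbb{C}:|z|=1\}$. Let $(\Phi_n)_{n\ge0}$ be the monic orthogonal polynomials in $L^2_\mu$; the Schur parameters are $a_n=\Phi_n(0)$, $n\ge1$ ($|a_n|<1$), so that $\Phi_0=1$, $\Phi_n(z)=z\Phi_{n-1}(z)+a_n\Phi_{n-1}^*(z)$, where $p^*(z):=z^n\overline p(z^{-1})$ for a polynomial $p$ of degree $n$ ($\overline p$ has the conjugated coefficients). The monic second kind polynomials are $\Psi_0=1$, $\Psi_n(z)=z\Psi_{n-1}(z)-a_n\Psi_{n-1}^*(z)$. For $u\in\mathbb{T}$ let $\Phi_n^u(z):=z\Phi_{n-1}(z)+u\Phi_{n-1}^*(z)$ and $\Psi_n^u(z):=z\Psi_{n-1}(z)-u\Psi_{n-1}^*(z)$. The modified approximants are the rational functions $$K_{2n}(a_1,\dots,a_{n-1},u;z)=-\frac{\Psi_n^u(z)}{\Phi_n^u(z)},\qquad n\ge1.$$ $F_\mu(z):=\int_{\mathbb{T}}\frac{\lambda+z}{\lambda-z}\,d\mu(\lambda)$ is the Carathéodory function of $\mu$, defined for $z\in\mathbb{C}\setminus\mathrm{supp}\,\mu$. $\Sigma_n(\boldsymbol{a};\boldsymbol{u}):=\{z\in\mathbb{C}:\Phi_n^{u_n}(z)=0\}$, and for a sequence $(E_n)_{n\ge1}$ of subsets of $\mathbb{C}$, $\overline{\lim}_nE_n:=\{\lambda\in\mathbb{C}:\liminf_nd(\lambda,E_n)=0\}$, $d$ being the distance from a point to a set. On a given compact set the approximants need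 only be defined for large enough indices. *)

theory Defs
  imports "HOL-Probability.Probability" "HOL-Computational_Algebra.Polynomial"
begin

abbreviation unit_circle :: "complex set" ("\<T>") where
  "\<T> \<equiv> sphere 0 1"

definition measure_supp :: "'a::topological_space measure \<Rightarrow> 'a set" where
  "measure_supp M = {x \<in> space M. \<forall>U. open U \<and> x \<in> U \<longrightarrow> emeasure M (U \<inter> space M) > 0}"

definition monic_orthogonal_polys :: "complex measure \<Rightarrow> (nat \<Rightarrow> complex poly) \<Rightarrow> bool" where
  "monic_orthogonal_polys \<mu> \<Phi> \<longleftrightarrow>
     (\<forall>n. degree (\<Phi> n) = n \<and> lead_coeff (\<Phi> n) = 1) \<and>
     (\<forall>m n. m \<noteq> n \<longrightarrow> (LINT z|\<mu>. poly (\<Phi> m) z * cnj (poly (\<Phi> n) z)) = 0)"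

text \<open>The Schur parameters are indexed by \<open>n \<ge> 1\<close>; the value at index 0 is irrelevant.\<close>

definition schur_parameters :: "complex measure \<Rightarrow> (nat \<Rightarrow> complex) \<Rightarrow> bool" where
  "schur_parameters \<mu> a \<longleftrightarrow>
     (\<exists>\<Phi>. monic_orthogonal_polys \<mu> \<Phi> \<and> (\<forall>n\<ge>1. a n = poly (\<Phi> n) 0))"

text \<open>\<open>p*(z) = z^n cnj_p(1/z)\<close>, where \<open>n\<close> is the exact degree of \<open>p\<close> and \<open>cnj_p\<close> has the
  conjugated coefficients. It is applied below to monic polynomials of degree \<open>n\<close> only.\<close>

definition star_poly :: "complex poly \<Rightarrow> complex poly" where
  "star_poly p = reflect_poly (map_poly cnj p)"

text \<open>The first and second kind polynomials as functions of the Schur parameters (Szego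
  recurrence). When \<open>a\<close> is the sequence of Schur parameters of \<open>\<mu>\<close>, \<open>Phi_poly a\<close> is the
  sequence of monic orthogonal polynomials of \<open>\<mu>\<close>.\<close>

primrec Phi_poly :: "(nat \<Rightarrow> complex) \<Rightarrow> nat \<Rightarrow> complex poly" where
  "Phi_poly a 0 = 1"
| "Phi_poly a (Suc n) = pCons 0 (Phi_poly a n) + smult (a (Suc n)) (star_poly (Phi_poly a n))"

primrec Psi_poly :: "(nat \<Rightarrow> complex) \<Rightarrow> nat \<Rightarrow> complex poly" where
  "Psi_poly a 0 = 1"
| "Psi_poly a (Suc n) = pCons 0 (Psi_poly a n) - smult (a (Suc n)) (star_poly (Psi_poly a n))"

text \<open>The following are meaningful for \<open>n \<ge> 1\<close> only.\<close>

definition Phi_para :: "(nat \<Rightarrow> complex) \<Rightarrow> complex \<Rightarrow> nat \<Rightarrow> complex poly" where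
  "Phi_para a v n = pCons 0 (Phi_poly a (n - 1)) + smult v (star_poly (Phi_poly a (n - 1)))"

definition Psi_para :: "(nat \<Rightarrow> complex) \<Rightarrow> complex \<Rightarrow> nat \<Rightarrow> complex poly" where
  "Psi_para a v n = pCons 0 (Psi_poly a (n - 1)) - smult v (star_poly (Psi_poly a (n - 1)))"

text \<open>\<open>mod_approximant a v n z\<close> is \<open>K\<^sub>2\<^sub>n(a\<^sub>1, \<dots>, a\<^sub>n\<^sub>-\<^sub>1, v; z)\<close>. Because division is total it has
  the value 0 at zeros of the denominator, where the approximant is undefined.\<close>

definition mod_approximant :: "(nat \<Rightarrow> complex) \<Rightarrow> complex \<Rightarrow> nat \<Rightarrow> complex \<Rightarrow> complex" where
  "mod_approximant a v n z = - (poly (Psi_para a v n) z / poly (Phi_para a v n) z)"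

text \<open>Meaningful only outside \<open>measure_supp \<mu>\<close>.\<close>

definition caratheodory_fun :: "complex measure \<Rightarrow> complex \<Rightarrow> complex" where
  "caratheodory_fun \<mu> z = (LINT w|\<mu>. (w + z) / (w - z))"

definition para_zeros :: "(nat \<Rightarrow> complex) \<Rightarrow> (nat \<Rightarrow> complex) \<Rightarrow> nat \<Rightarrow> complex set" where
  "para_zeros a u n = {z. poly (Phi_para a (u n) n) z = 0}"

text \<open>The distance is taken in \<open>ereal\<close>, so that the distance to the empty set is infinite
  (\<open>infdist\<close> would give 0).\<close>

definition upper_set_limit :: "(nat \<Rightarrow> 'a::metric_space set) \<Rightarrow> 'a set" where
  "upper_set_limit E = {x. liminf (\<lambda>n. INF y\<in>E n. ereal (dist x y)) = 0}"

text \<open>Convergence of the modified approximants to the Caratheodory function, along the filter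
  \<open>F\<close> of indices and uniformly on compact subsets of \<open>S\<close>: the limit is defined on \<open>S\<close> and, on
  each compact subset of \<open>S\<close>, the approximants are eventually defined and converge uniformly.\<close>

definition approximants_converge ::
    "complex measure \<Rightarrow> (nat \<Rightarrow> complex) \<Rightarrow> (nat \<Rightarrow> complex) \<Rightarrow> nat filter \<Rightarrow> complex set \<Rightarrow> bool" where
  "approximants_converge \<mu> a u F S \<longleftrightarrow>
     S \<inter> measure_supp \<mu> = {} \<and>
     (\<forall>K. compact K \<and> K \<subseteq> S \<longrightarrow>
        (\<forall>\<^sub>F n in F. \<forall>z\<in>K. poly (Phi_para a (u n) n) z \<noteq> 0) \<and>
        uniform_limit K (\<lambda>n. mod_approximant a (u n) n) (caratheodory_fun \<mu>) F)"

end

theory Submission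
  imports Defs "HOL-Computational_Algebra.Fundamental_Theorem_Algebra"
begin

text \<open>
  Write \<open>\<Sigma>\<^sub>n\<close> for the zero set of \<open>\<Phi>\<^sub>n\<^sup>u\<close>, \<open>u = u\<^sub>n\<close>, and \<open>K\<^sub>n(z, w)\<close> for the Christoffel-Darboux kernel
  of the orthonormal polynomials of degree less than \<open>n\<close>.

  The \<open>n\<close> zeros of \<open>\<Phi>\<^sub>n\<^sup>u\<close> are simple and lie on the circle, and the kernels \<open>K\<^sub>n(\<cdot>, l)\<close>,
  \<open>l \<in> \<Sigma>\<^sub>n\<close>, are multiples of the Lagrange basis at the zeros. As \<open>K\<^sub>n(\<cdot>, l)\<close> has integral \<open>1\<close>, the
  measure \<open>\<mu>\<^sub>n\<close> with mass \<open>1 / K\<^sub>n(l, l)\<close> at each \<open>l \<in> \<Sigma>\<^sub>n\<close> integrates \<open>w\<^sup>k\<close> exactly for \<open>\<bar>k\<bar> < n\<close>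
  (\<open>quad_poly\<close>). Lagrange interpolation of \<open>\<Psi>\<^sub>n\<^sup>u - \<Phi>\<^sub>n\<^sup>u\<close>, together with the Wronskian of the two
  kinds of polynomials, identifies the modified approximant with the Caratheodory function of \<open>\<mu>\<^sub>n\<close>
  (\<open>mod_approximant_partial_fractions\<close>).

  By the Weierstrass theorem \<open>\<mu>\<^sub>n\<close> converges weakly to \<open>\<mu>\<close> (\<open>quad_tendsto\<close>). Where \<open>z\<close> keeps a
  positive distance from the support of \<open>\<mu>\<close> and from the zeros, the kernel \<open>(w + z) / (w - z)\<close> can be
  replaced by a continuous one, and weak convergence becomes uniform convergence of the approximants
  on compact sets, along any set of indices (\<open>approximants_converge_if_zeros_separated\<close>). Weak
  convergence also puts the support inside the upper limit of \<open>\<Sigma>\<^sub>n\<close>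
  (\<open>measure_supp_subset_upper_set_limit\<close>), and the first claim follows.

  For the second claim, a point off the support has the required neighbourhood unless its distance
  to \<open>\<Sigma>\<^sub>n\<close> tends to \<open>0\<close> along the whole sequence, and this happens at one point at most
  (\<open>zero_limit_off_supp_unique\<close>). Consider \<open>c\<^sub>n = \<Phi>\<^sub>n / \<Phi>\<^sub>n\<^sup>*\<close>, which is unimodular on the circle. All
  points of \<open>\<Sigma>\<^sub>n\<close> give \<open>c\<^sub>n\<close> the same value, while on \<open>\<Sigma>\<^sub>n\<^sub>+\<^sub>1\<close> it is \<open>z c\<^sub>n(z)\<close> that is constant. Off the
  support \<open>c\<^sub>n\<close> is Lipschitz with a constant independent of \<open>n\<close> (\<open>szego_phase_lipschitz_off_supp\<close>),
  because there \<open>\<bar>\<Phi>\<^sub>n\<bar>\<^sup>2\<close> dominates the diagonal of the kernel. So two points that are both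
  approached by zeros of all large degrees must coincide: \<open>c\<^sub>n\<close> and \<open>z c\<^sub>n\<close> take nearly the same
  value at both.
\<close>

section \<open>The Szego recurrence\<close>

lemma circle_inverse: "cmod w = 1 \<Longrightarrow> w * cnj w = 1"
  by (simp add: complex_norm_square[symmetric])

lemma degree_map_poly_cnj [simp]: "degree (map_poly cnj p) = degree p"
  by (rule degree_map_poly) auto

lemma coeff_star_poly:
  "coeff (star_poly p) k = (if k > degree p then 0 else cnj (coeff p (degree p - k)))"
  by (simp add: star_poly_def coeff_reflect_poly coeff_map_poly)

lemma degree_star_poly_le: "degree (star_poly p) \<le> degree p"
  by (simp add: degree_le coeff_star_poly)

lemma poly_star_poly_circle:
  assumes "cmod z = 1"
  shows "poly (star_poly p) z = z ^ degree p * cnj (poly p z)"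
proof -
  have "z \<noteq> 0" "inverse z = cnj z"
    using assms inverse_unique[OF circle_inverse[OF assms]] by auto
  then show ?thesis
    by (simp add: star_poly_def poly_reflect_poly_nz)
qed

lemma Phi_poly_degree_monic:
  "degree (Phi_poly a n) = n \<and> coeff (Phi_poly a n) n = 1"
proof (induction n)
  case (Suc n)
  have "degree (smult (a (Suc n)) (star_poly (Phi_poly a n))) < Suc n"
    using Suc degree_star_poly_le[of "Phi_poly a n"] degree_smult_le[of "a (Suc n)" "star_poly (Phi_poly a n)"]
    by linarith
  moreover have "degree (pCons 0 (Phi_poly a n)) = Suc n"
    using Suc by (metis coeff_0 degree_pCons_eq zero_neq_one)
  ultimately show ?case
    using Suc by (simp add: degree_add_eq_left coeff_star_poly)
qed simp

lemma degree_Phi_poly [simp]: "degree (Phi_poly a n) = n"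
  and coeff_Phi_poly_degree [simp]: "coeff (Phi_poly a n) n = 1"
  using Phi_poly_degree_monic by auto

lemma degree_star_Phi_poly_le: "degree (star_poly (Phi_poly a n)) \<le> n"
  using degree_star_poly_le[of "Phi_poly a n"] by simp

lemma Psi_poly_eq_Phi_poly: "Psi_poly a n = Phi_poly (\<lambda>k. - a k) n"
  by (induction n) simp_all

lemma star_poly_1 [simp]: "star_poly 1 = 1"
  by (simp add: star_poly_def)

lemma star_Phi_poly_Suc:
  "star_poly (Phi_poly a (Suc n)) =
     star_poly (Phi_poly a n) + smult (cnj (a (Suc n))) (pCons 0 (Phi_poly a n))"
proof (rule poly_eqI)
  fix k
  have d: "degree (Phi_poly a (Suc n)) = Suc n" by (rule degree_Phi_poly)
  consider "k = 0" | j where "k = Suc j" "j < n" | "k = Suc n" | "k > Suc n"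
    by (metis not0_implies_Suc not_less_eq linorder_neqE_nat)
  then show "coeff (star_poly (Phi_poly a (Suc n))) k =
      coeff (star_poly (Phi_poly a n) + smult (cnj (a (Suc n))) (pCons 0 (Phi_poly a n))) k"
    unfolding coeff_star_poly d
  proof cases
    case 2
    then have "Suc n - k = Suc (n - k)" "n - (n - j) = j" "n - j = Suc (n - k)" by auto
    with 2 show "(if Suc n < k then 0 else cnj (coeff (Phi_poly a (Suc n)) (Suc n - k))) =
        coeff (star_poly (Phi_poly a n) + smult (cnj (a (Suc n))) (pCons 0 (Phi_poly a n))) k"
      by (simp add: coeff_star_poly)
  qed (auto simp: coeff_star_poly coeff_eq_0 Phi_poly.simps(2))
qed

declare Phi_poly.simps(2) [simp del]

lemma poly_Phi_poly_Suc:
  "poly (Phi_poly a (Suc n)) z =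
     z * poly (Phi_poly a n) z + a (Suc n) * poly (star_poly (Phi_poly a n)) z"
  by (simp add: Phi_poly.simps(2))

lemma poly_star_Phi_poly_Suc:
  "poly (star_poly (Phi_poly a (Suc n))) z =
     poly (star_poly (Phi_poly a n)) z + cnj (a (Suc n)) * (z * poly (Phi_poly a n) z)"
  by (simp add: star_Phi_poly_Suc)

text \<open>The squared norms of the monic orthogonal polynomials, in terms of the Schur
  parameters.\<close>

definition szego_norm :: "(nat \<Rightarrow> complex) \<Rightarrow> nat \<Rightarrow> real" where
  "szego_norm a n = (\<Prod>k=1..n. 1 - (cmod (a k))\<^sup>2)"

lemma szego_norm_0 [simp]: "szego_norm a 0 = 1"
  and szego_norm_Suc: "szego_norm a (Suc n) = (1 - (cmod (a (Suc n)))\<^sup>2) * szego_norm a n"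
  by (simp_all add: szego_norm_def mult.commute)

lemma szego_norm_pos:
  assumes "\<forall>k\<ge>1. cmod (a k) < 1"
  shows "szego_norm a n > 0"
  using assms by (auto simp: szego_norm_def abs_square_less_1 intro!: prod_pos)

text \<open>A Wronskian identity: the recurrence multiplies the left-hand side by
  \<open>z (1 - \<bar>a\<^sub>n\<bar>\<^sup>2)\<close> at each step, and with it \<open>z\<^sup>n\<close> and the squared norm on the right.\<close>

lemma Psi_Phi_wronskian:
  "poly (Psi_poly a n) z * poly (star_poly (Phi_poly a n)) z
     + poly (Phi_poly a n) z * poly (star_poly (Psi_poly a n)) z
   = 2 * of_real (szego_norm a n) * z ^ n"
proof (induction n)
  case (Suc n)
  have h: "of_real (szego_norm a (Suc n)) = (1 - a (Suc n) * cnj (a (Suc n))) * of_real (szego_norm a n)"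
    by (simp add: szego_norm_Suc complex_norm_square[symmetric])
  have *: "(z * B - \<alpha> * T) * (S + \<beta> * (z * A)) + (z * A + \<alpha> * S) * (T - \<beta> * (z * B))
      = z * (1 - \<alpha> * \<beta>) * (B * S + A * T)" for A B S T \<alpha> \<beta> :: complex
    by (simp add: algebra_simps)
  show ?case
    unfolding h Psi_poly_eq_Phi_poly
    using Suc[unfolded Psi_poly_eq_Phi_poly]
      *[of "poly (Phi_poly (\<lambda>k. - a k) n) z" "a (Suc n)" "poly (star_poly (Phi_poly (\<lambda>k. - a k) n)) z"
        "poly (star_poly (Phi_poly a n)) z" "cnj (a (Suc n))" "poly (Phi_poly a n) z"]
    by (simp add: poly_Phi_poly_Suc poly_star_Phi_poly_Suc)
qed simp


section \<open>The Christoffel-Darboux kernel\<close>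

text \<open>The kernel \<open>K\<^sub>n(z, w)\<close> as a polynomial in its first argument. For the Schur parameters of a
  measure it is the reproducing kernel of the polynomials of degree less than \<open>n\<close>.\<close>

definition cd_poly :: "(nat \<Rightarrow> complex) \<Rightarrow> nat \<Rightarrow> complex \<Rightarrow> complex poly" where
  "cd_poly a n w = (\<Sum>k<n. smult (cnj (poly (Phi_poly a k) w) / of_real (szego_norm a k)) (Phi_poly a k))"

lemma poly_cd_poly:
  "poly (cd_poly a n w) z =
     (\<Sum>k<n. poly (Phi_poly a k) z * cnj (poly (Phi_poly a k) w) / of_real (szego_norm a k))"
  by (simp add: cd_poly_def poly_sum mult.commute)

lemma degree_cd_poly_le: "degree (cd_poly a (Suc n) w) \<le> n"
  unfolding cd_poly_def
  by (rule degree_sum_le) (auto intro: order_trans[OF degree_smult_le])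

text \<open>Passing from the first form to the second adds one term to the kernel; passing from the
  second form for \<open>n\<close> to the first form for \<open>Suc n\<close> is one step of the recurrence, which
  preserves the Hermitian form \<open>\<bar>X\<bar>\<^sup>2 - \<bar>Y\<bar>\<^sup>2\<close> up to the factor \<open>1 - \<bar>a\<^sub>n\<^sub>+\<^sub>1\<bar>\<^sup>2\<close>.\<close>

lemma christoffel_darboux:
  assumes a: "\<forall>k\<ge>1. cmod (a k) < 1"
  shows "of_real (szego_norm a n) * (1 - z * cnj w) * poly (cd_poly a n w) z =
      poly (star_poly (Phi_poly a n)) z * cnj (poly (star_poly (Phi_poly a n)) w)
      - poly (Phi_poly a n) z * cnj (poly (Phi_poly a n) w)" (is "?first n")
    and "of_real (szego_norm a n) * (1 - z * cnj w) * poly (cd_poly a (Suc n) w) z =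
      poly (star_poly (Phi_poly a n)) z * cnj (poly (star_poly (Phi_poly a n)) w)
      - z * cnj w * poly (Phi_poly a n) z * cnj (poly (Phi_poly a n) w)" (is "?second n")
proof -
  have step: "?second n" if "?first n" for n
  proof -
    have "of_real (szego_norm a n) \<noteq> (0::complex)"
      using szego_norm_pos[OF a, of n] by simp
    then have "of_real (szego_norm a n) * (1 - z * cnj w) * poly (cd_poly a (Suc n) w) z =
        of_real (szego_norm a n) * (1 - z * cnj w) * poly (cd_poly a n w) z
        + (1 - z * cnj w) * (poly (Phi_poly a n) z * cnj (poly (Phi_poly a n) w))"
      by (simp add: poly_cd_poly field_simps)
    with that show ?thesis
      by (simp add: algebra_simps)
  qed
  have first: "?first n" for n
  proof (induction n)
    case 0
    show ?case by (simp add: cd_poly_def)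
  next
    case (Suc n)
    have h: "of_real (szego_norm a (Suc n)) = (1 - a (Suc n) * cnj (a (Suc n))) * of_real (szego_norm a n)"
      by (simp add: szego_norm_Suc complex_norm_square[symmetric])
    have *: "(S + \<beta> * (z * A)) * (S' + \<alpha> * (w' * A')) - (z * A + \<alpha> * S) * (w' * A' + \<beta> * S')
        = (1 - \<alpha> * \<beta>) * (S * S' - z * w' * A * A')" for S A S' A' \<alpha> \<beta> w' :: complex
      by (simp add: algebra_simps)
    show ?case
      unfolding h using step[OF Suc]
        *[of "poly (star_poly (Phi_poly a n)) z" "cnj (a (Suc n))" "poly (Phi_poly a n) z"
         "cnj (poly (star_poly (Phi_poly a n)) w)" "a (Suc n)" "cnj w" "cnj (poly (Phi_poly a n) w)"]
      by (simp add: poly_Phi_poly_Suc poly_star_Phi_poly_Suc mult.assoc)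
  qed
  show "?first n" by (rule first)
  show "?second n" by (rule step[OF first])
qed

definition cd_diag :: "(nat \<Rightarrow> complex) \<Rightarrow> nat \<Rightarrow> complex \<Rightarrow> real" where
  "cd_diag a n z = (\<Sum>k<n. (cmod (poly (Phi_poly a k) z))\<^sup>2 / szego_norm a k)"

lemma poly_cd_poly_diag: "poly (cd_poly a n z) z = of_real (cd_diag a n z)"
  by (simp add: poly_cd_poly cd_diag_def complex_norm_square[symmetric])

lemma cd_diag_Suc_ge_1:
  assumes "\<forall>k\<ge>1. cmod (a k) < 1"
  shows "cd_diag a (Suc n) z \<ge> 1"
proof -
  have "(\<Sum>k\<in>{0}. (cmod (poly (Phi_poly a k) z))\<^sup>2 / szego_norm a k) \<le> cd_diag a (Suc n) z"
    unfolding cd_diag_def using szego_norm_pos[OF assms]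
    by (intro sum_mono2) (auto intro!: divide_nonneg_pos)
  then show ?thesis by simp
qed

lemma cd_poly_cauchy_schwarz:
  assumes a: "\<forall>k\<ge>1. cmod (a k) < 1"
  shows "(cmod (poly (cd_poly a n w) z))\<^sup>2 \<le> cd_diag a n z * cd_diag a n w"
proof -
  define f g where "f = (\<lambda>k. cmod (poly (Phi_poly a k) z) / sqrt (szego_norm a k))"
    and "g = (\<lambda>k. cmod (poly (Phi_poly a k) w) / sqrt (szego_norm a k))"
  note h = szego_norm_pos[OF a]
  have "cmod (poly (cd_poly a n w) z) \<le> (\<Sum>k<n. f k * g k)"
    unfolding poly_cd_poly
    using h by (intro sum_norm_le) (simp add: f_def g_def norm_mult norm_divide less_imp_le)
  then have "(cmod (poly (cd_poly a n w) z))\<^sup>2 \<le> (\<Sum>k<n. f k * g k)\<^sup>2"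
    by (intro power_mono) auto
  also have "\<dots> \<le> (\<Sum>k<n. (f k)\<^sup>2) * (\<Sum>k<n. (g k)\<^sup>2)"
    by (rule Cauchy_Schwarz_ineq_sum)
  finally show ?thesis
    using h by (simp add: f_def g_def cd_diag_def power_divide less_imp_le)
qed

lemma Phi_poly_circle_nonzero:
  assumes a: "\<forall>k\<ge>1. cmod (a k) < 1" and z: "cmod z = 1"
  shows "poly (Phi_poly a n) z \<noteq> 0"
proof
  assume 0: "poly (Phi_poly a n) z = 0"
  show False
    using 0
  proof (induction n)
    case (Suc n)
    let ?A = "poly (Phi_poly a n) z"
    have "z * ?A = - (a (Suc n) * poly (star_poly (Phi_poly a n)) z)"
      using Suc.prems by (simp add: eq_neg_iff_add_eq_0 poly_Phi_poly_Suc)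
    then have "cmod (z * ?A) = cmod (- (a (Suc n) * poly (star_poly (Phi_poly a n)) z))"
      by simp
    then have "cmod ?A = cmod (a (Suc n)) * cmod ?A"
      by (simp add: norm_mult norm_power z poly_star_poly_circle[OF z])
    with a[rule_format, of "Suc n"] have "?A = 0"
      by (metis (no_types) Suc_le_mono le0 One_nat_def less_irrefl mult_cancel_right1 norm_eq_zero)
    then show False by (rule Suc.IH)
  qed simp
qed


section \<open>Zeros of the para-orthogonal polynomials and the quadrature weights\<close>

lemma Phi_para_Suc:
  "Phi_para a v (Suc m) = pCons 0 (Phi_poly a m) + smult v (star_poly (Phi_poly a m))"
  by (simp add: Phi_para_def)

text \<open>A para-orthogonal polynomial is one more step of the recurrence, with a parameter on the
  circle in place of a Schur parameter.\<close>

lemma Phi_para_eq_Phi_poly: "Phi_para a v (Suc m) = Phi_poly (a(Suc m := v)) (Suc m)"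
proof -
  have "Phi_poly (a(Suc m := v)) k = Phi_poly a k" if "k \<le> m" for k
    using that by (induction k) (auto simp: Phi_poly.simps(2))
  then show ?thesis by (simp add: Phi_para_Suc Phi_poly.simps(2))
qed

lemma Psi_para_eq_Phi_para: "Psi_para a v n = Phi_para (\<lambda>k. - a k) (- v) n"
  by (simp add: Psi_para_def Phi_para_def Psi_poly_eq_Phi_poly)

lemma degree_Phi_para: "degree (Phi_para a v (Suc m)) = Suc m"
  and coeff_Phi_para: "coeff (Phi_para a v (Suc m)) (Suc m) = 1"
  by (simp_all only: Phi_para_eq_Phi_poly degree_Phi_poly coeff_Phi_poly_degree)

lemma Phi_para_zero_iff:
  "poly (Phi_para a v (Suc m)) z = 0 \<longleftrightarrow>
     z * poly (Phi_poly a m) z = - v * poly (star_poly (Phi_poly a m)) z"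
  by (simp add: Phi_para_Suc eq_neg_iff_add_eq_0)

text \<open>At a zero \<open>\<bar>z \<Phi>\<bar> = \<bar>\<Phi>\<^sup>*\<bar>\<close>, so the second Christoffel-Darboux formula gives
  \<open>(1 - \<bar>z\<bar>\<^sup>2) K(z, z) = 0\<close>, while the kernel is positive on the diagonal.\<close>

lemma Phi_para_zero_on_circle:
  assumes a: "\<forall>k\<ge>1. cmod (a k) < 1" and v: "cmod v = 1"
    and z: "poly (Phi_para a v (Suc m)) z = 0"
  shows "cmod z = 1"
proof -
  let ?A = "poly (Phi_poly a m) z" and ?S = "poly (star_poly (Phi_poly a m)) z"
  have "cmod (z * ?A) = cmod ?S"
    using z v by (simp add: Phi_para_zero_iff norm_mult)
  then have "(z * ?A) * cnj (z * ?A) = ?S * cnj ?S"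
    by (simp only: complex_norm_square[symmetric])
  then have "of_real (szego_norm a m) * (1 - z * cnj z) * poly (cd_poly a (Suc m) z) z = 0"
    by (subst christoffel_darboux(2)[OF a]) (simp add: mult_ac)
  moreover have "poly (cd_poly a (Suc m) z) z \<noteq> 0" "of_real (szego_norm a m) \<noteq> (0::complex)"
    using cd_diag_Suc_ge_1[OF a, of m z] szego_norm_pos[OF a, of m] by (auto simp: poly_cd_poly_diag)
  ultimately have "complex_of_real ((cmod z)\<^sup>2) = 1"
    by (simp add: complex_norm_square del: of_real_power)
  then have "(cmod z)\<^sup>2 = 1"
    by (metis of_real_eq_1_iff)
  then show ?thesis
    by (simp add: power2_eq_1_iff) (use norm_ge_zero[of z] in linarith)
qed

text \<open>When the second argument is a zero \<open>l\<close>, the right-hand side of the second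
  Christoffel-Darboux formula becomes a multiple of the para-orthogonal polynomial. Up to a
  constant, \<open>K(\<cdot>, l)\<close> is therefore that polynomial divided by its factor \<open>z - l\<close>.\<close>

lemma Phi_para_zero_kernel:
  assumes a: "\<forall>k\<ge>1. cmod (a k) < 1" and v: "cmod v = 1"
    and l: "poly (Phi_para a v (Suc m)) l = 0"
  shows "smult (of_real (szego_norm a m)) ([:1, - cnj l:] * cd_poly a (Suc m) l) =
    smult (cnj v * cnj (poly (star_poly (Phi_poly a m)) l)) (Phi_para a v (Suc m))"
proof -
  have root: "cnj l * cnj (poly (Phi_poly a m) l) = - (cnj v * cnj (poly (star_poly (Phi_poly a m)) l))"
    using arg_cong[OF l[unfolded Phi_para_zero_iff], of cnj] by simp
  have vv: "v * cnj v = 1"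
    using v by (simp add: complex_norm_square[symmetric])
  have "poly (smult (of_real (szego_norm a m)) ([:1, - cnj l:] * cd_poly a (Suc m) l)) z =
      poly (smult (cnj v * cnj (poly (star_poly (Phi_poly a m)) l)) (Phi_para a v (Suc m))) z" for z
  proof -
    have alg: "S * S' - z * c * A * A' = b * S' * (z * A + v * S)"
      if "c * A' = - (b * S')" "v * b = 1" for S S' A A' b c :: complex
      using that by algebra
    have "poly (smult (of_real (szego_norm a m)) ([:1, - cnj l:] * cd_poly a (Suc m) l)) z =
        of_real (szego_norm a m) * (1 - z * cnj l) * poly (cd_poly a (Suc m) l) z"
      by (simp only: poly_smult poly_mult mult.assoc) simp
    also have "\<dots> = cnj v * cnj (poly (star_poly (Phi_poly a m)) l) *
        (z * poly (Phi_poly a m) z + v * poly (star_poly (Phi_poly a m)) z)"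
      unfolding christoffel_darboux(2)[OF a] by (rule alg[OF root vv])
    finally show ?thesis
      by (simp add: Phi_para_Suc)
  qed
  then show ?thesis
    by (simp add: poly_eq_poly_eq_iff[symmetric] fun_eq_iff del: poly_smult poly_mult)
qed


text \<open>Differentiating the identity \<open>Phi_para_zero_kernel\<close> at \<open>l\<close> leaves \<open>K(l, l) \<ge> 1\<close> times a
  nonzero constant on the left, so \<open>l\<close> is a simple zero.\<close>

lemma Phi_para_rsquarefree:
  assumes a: "\<forall>k\<ge>1. cmod (a k) < 1" and v: "cmod v = 1"
  shows "rsquarefree (Phi_para a v (Suc m))"
  unfolding rsquarefree_roots
proof (intro allI notI)
  fix l
  let ?B = "Phi_para a v (Suc m)"
  assume l: "poly ?B l = 0 \<and> poly (pderiv ?B) l = 0"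
  have l1: "cmod l = 1" using l by (intro Phi_para_zero_on_circle[OF a v]) auto
  have der: "poly (pderiv (smult h ([:1, - c:] * K))) l =
      h * ((1 - l * c) * poly (pderiv K) l - c * poly K l)" for h c and K :: "complex poly"
    unfolding pderiv_smult pderiv_mult by (simp add: pderiv_pCons algebra_simps del: mult_pCons_left mult_pCons_right)
  have "poly (pderiv (smult (of_real (szego_norm a m)) ([:1, - cnj l:] * cd_poly a (Suc m) l))) l = 0"
    using l by (simp only: Phi_para_zero_kernel[OF a v conjunct1[OF l]] pderiv_smult poly_smult) simp
  then have "of_real (szego_norm a m) * ((1 - l * cnj l) * poly (pderiv (cd_poly a (Suc m) l)) l
      - cnj l * poly (cd_poly a (Suc m) l) l) = 0"
    by (simp only: der)
  moreover have "l * cnj l = 1"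
    using l1 by (simp add: complex_norm_square[symmetric])
  ultimately have "of_real (szego_norm a m) * cnj l * poly (cd_poly a (Suc m) l) l = 0"
    by simp
  then show False
    using cd_diag_Suc_ge_1[OF a, of m l] szego_norm_pos[OF a, of m] l1
    by (auto simp: poly_cd_poly_diag)
qed

lemma
  assumes a: "\<forall>k\<ge>1. cmod (a k) < 1" and v: "cmod v = 1"
  shows finite_Phi_para_zeros: "finite {z. poly (Phi_para a v (Suc m)) z = 0}"
    and card_Phi_para_zeros: "card {z. poly (Phi_para a v (Suc m)) z = 0} = Suc m"
proof -
  let ?B = "Phi_para a v (Suc m)"
  have "?B \<noteq> 0" using degree_Phi_para[of a v m] by auto
  then show fin: "finite {z. poly ?B z = 0}" by (rule poly_roots_finite)
  have "smult (lead_coeff ?B) (\<Prod>z\<in>{z. poly ?B z = 0}. [:-z, 1:]) = ?B"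
    by (rule complex_poly_decompose_rsquarefree[OF Phi_para_rsquarefree[OF a v]])
  then have "degree (\<Prod>z\<in>{z. poly ?B z = 0}. [:-z, 1:]) = Suc m"
    using degree_Phi_para[of a v m] coeff_Phi_para[of a v m] by (metis smult_1_left)
  then show "card {z. poly ?B z = 0} = Suc m"
    by (subst (asm) degree_prod_eq_sum_degree) auto
qed

text \<open>Up to normalization the kernels centred at the zeros form the Lagrange basis of the
  interpolation problem at the zeros.\<close>

lemma cd_poly_Phi_para_zeros:
  assumes a: "\<forall>k\<ge>1. cmod (a k) < 1" and v: "cmod v = 1"
    and l: "poly (Phi_para a v (Suc m)) l = 0" and l': "poly (Phi_para a v (Suc m)) l' = 0"
    and "l \<noteq> l'"
  shows "poly (cd_poly a (Suc m) l) l' = 0"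
proof -
  have "l * cnj l = 1"
    using Phi_para_zero_on_circle[OF a v l] by (simp add: complex_norm_square[symmetric])
  then have "1 - l' * cnj l \<noteq> 0"
    using \<open>l \<noteq> l'\<close> by (metis eq_iff_diff_eq_0 mult_cancel_right mult_zero_right zero_neq_one)
  moreover have "of_real (szego_norm a m) * (1 - l' * cnj l) * poly (cd_poly a (Suc m) l) l' = 0"
    using arg_cong[OF Phi_para_zero_kernel[OF a v l], of "\<lambda>p. poly p l'"] l'
    by (simp add: algebra_simps)
  ultimately show ?thesis
    using szego_norm_pos[OF a, of m] by auto
qed

lemma lagrange_interpolation_Phi_para_zeros:
  assumes a: "\<forall>k\<ge>1. cmod (a k) < 1" and v: "cmod v = 1" and p: "degree p \<le> m"
  defines "Z \<equiv> {z. poly (Phi_para a v (Suc m)) z = 0}"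
  shows "p = (\<Sum>l\<in>Z. smult (poly p l / of_real (cd_diag a (Suc m) l)) (cd_poly a (Suc m) l))"
    (is "p = ?q")
proof (rule poly_eqI_degree[where A = Z])
  have fin: "finite Z" and card: "card Z = Suc m"
    unfolding Z_def by (rule finite_Phi_para_zeros[OF a v] card_Phi_para_zeros[OF a v])+
  show "degree p < card Z" using p card by simp
  have "degree ?q \<le> m"
    using fin by (intro degree_sum_le order_trans[OF degree_smult_le] degree_cd_poly_le)
  then show "degree ?q < card Z" using card by simp
  fix l' assume l': "l' \<in> Z"
  have "poly ?q l' = (\<Sum>l\<in>Z. if l = l' then poly p l' else 0)"
    unfolding poly_sum
  proof (rule sum.cong[OF refl])
    fix l assume "l \<in> Z"
    show "poly (smult (poly p l / of_real (cd_diag a (Suc m) l)) (cd_poly a (Suc m) l)) l' =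
        (if l = l' then poly p l' else 0)"
    proof (cases "l = l'")
      case True
      then show ?thesis
        using cd_diag_Suc_ge_1[OF a, of m l'] by (simp add: poly_cd_poly_diag)
    next
      case False
      then show ?thesis
        using cd_poly_Phi_para_zeros[OF a v _ _ False] \<open>l \<in> Z\<close> l' by (simp add: Z_def)
    qed
  qed
  then show "poly p l' = poly ?q l'" using fin l' by simp
qed

text \<open>Partial fractions. The difference \<open>\<Psi> - \<Phi>\<close> of the two para-orthogonal polynomials has
  degree at most \<open>m\<close>, hence is its own Lagrange interpolant; its values at the zeros of \<open>\<Phi>\<close>
  are those of \<open>\<Psi>\<close>, which the Wronskian identity determines. The weights must add up to
  \<open>1\<close>; they do when the recurrence comes from a probability measure.\<close>

lemma mod_approximant_partial_fractions:
  fixes a :: "nat \<Rightarrow> complex" and v z :: complex and m :: nat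
  assumes a: "\<forall>k\<ge>1. cmod (a k) < 1" and v: "cmod v = 1"
  defines "Z \<equiv> {z. poly (Phi_para a v (Suc m)) z = 0}"
  assumes mass: "(\<Sum>l\<in>Z. 1 / cd_diag a (Suc m) l) = 1"
    and z: "poly (Phi_para a v (Suc m)) z \<noteq> 0"
  shows "mod_approximant a v (Suc m) z =
    (\<Sum>l\<in>Z. of_real (1 / cd_diag a (Suc m) l) * ((l + z) / (l - z)))"
proof -
  let ?B = "Phi_para a v (Suc m)" and ?C = "Psi_para a v (Suc m)"
  let ?w = "\<lambda>l. complex_of_real (1 / cd_diag a (Suc m) l)"
  let ?h = "complex_of_real (szego_norm a m)"
  have h: "?h \<noteq> 0" using szego_norm_pos[OF a, of m] by simp
  have "degree (?C - ?B) \<le> m"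
  proof (rule degree_le, intro allI impI)
    fix i assume "m < i"
    then show "coeff (?C - ?B) i = 0"
      using coeff_Phi_para[of a v m] coeff_Phi_para[of "\<lambda>k. - a k" "- v" m]
        degree_Phi_para[of a v m] degree_Phi_para[of "\<lambda>k. - a k" "- v" m]
      by (cases "i = Suc m") (auto simp: Psi_para_eq_Phi_para coeff_eq_0)
  qed
  then have "poly (?C - ?B) z =
      poly (\<Sum>l\<in>Z. smult (poly (?C - ?B) l / of_real (cd_diag a (Suc m) l)) (cd_poly a (Suc m) l)) z"
    unfolding Z_def by (subst lagrange_interpolation_Phi_para_zeros[OF a v]) auto
  also have "\<dots> = (\<Sum>l\<in>Z. poly ?B z * (?w l * (- 2 * l / (l - z))))"
    unfolding poly_sum
  proof (rule sum.cong[OF refl])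
    fix l assume "l \<in> Z"
    then have l: "poly ?B l = 0" by (simp add: Z_def)
    define A S A' S' where "A = poly (Phi_poly a m) l" and "S = poly (star_poly (Phi_poly a m)) l"
      and "A' = poly (Psi_poly a m) l" and "S' = poly (star_poly (Psi_poly a m)) l"
    have l1: "cmod l = 1" by (rule Phi_para_zero_on_circle[OF a v l])
    then have ll: "l * cnj l = 1" by (simp add: complex_norm_square[symmetric])
    have lz: "l \<noteq> z" using l z by auto
    have zl: "l * (1 - z * cnj l) = l - z" using ll by (simp add: algebra_simps)
    have root: "l * A = - v * S"
      using l by (simp add: Phi_para_zero_iff A_def S_def)
    have vv: "v * cnj v = 1" using v by (simp add: complex_norm_square[symmetric])
    \<comment> \<open>The power is hidden in a variable so that the equations below are polynomial.\<close>
    define lm where "lm = l ^ m"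
    have wr: "A' * S + A * S' = 2 * ?h * lm"
      unfolding A'_def S'_def A_def S_def lm_def by (rule Psi_Phi_wronskian)
    have C: "poly ?C l = l * A' - v * S'"
      by (simp add: Psi_para_def A'_def S'_def)
    have CS: "poly ?C l * S = 2 * ?h * (l * lm)"
      using C root wr by algebra
    have "A = lm * cnj S"
      unfolding A_def S_def lm_def poly_star_poly_circle[OF l1] using l1
      by (simp add: power_mult_distrib[symmetric] ll mult.assoc[symmetric])
    then have vS: "(l * lm) * (cnj v * cnj S) = - S"
      using root vv by algebra
    have "(l * lm) * (poly ?C l * (cnj v * cnj S)) = (l * lm) * (- 2 * ?h)"
      using vS CS by algebra
    then have res: "poly ?C l * (cnj v * cnj S) = - 2 * ?h"
      using l1 by (subst (asm) mult_left_cancel) (auto simp: lm_def)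
    have K: "?h * (1 - z * cnj l) * poly (cd_poly a (Suc m) l) z = cnj v * cnj S * poly ?B z"
      using arg_cong[OF Phi_para_zero_kernel[OF a v l], of "\<lambda>p. poly p z"]
      by (simp add: S_def algebra_simps)
    have "?h * ((l - z) * (poly ?C l * poly (cd_poly a (Suc m) l) z)) = ?h * (- 2 * l * poly ?B z)"
      using K zl res by algebra
    then have "(l - z) * (poly ?C l * poly (cd_poly a (Suc m) l) z) = - 2 * l * poly ?B z"
      using h by (subst (asm) mult_left_cancel) auto
    then have "poly ?C l * poly (cd_poly a (Suc m) l) z = poly ?B z * (- 2 * l / (l - z))"
      using lz by (simp add: field_simps)
    then show "poly (smult (poly (?C - ?B) l / of_real (cd_diag a (Suc m) l)) (cd_poly a (Suc m) l)) z
        = poly ?B z * (?w l * (- 2 * l / (l - z)))"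
      using l by (simp add: field_simps)
  qed
  finally have "poly ?C z = poly ?B z * 1 + poly ?B z * (\<Sum>l\<in>Z. ?w l * (- 2 * l / (l - z)))"
    by (simp add: sum_distrib_left algebra_simps)
  also have "(1::complex) = (\<Sum>l\<in>Z. ?w l)"
    using mass by (metis of_real_1 of_real_sum)
  also have "poly ?B z * (\<Sum>l\<in>Z. ?w l) + poly ?B z * (\<Sum>l\<in>Z. ?w l * (- 2 * l / (l - z)))
      = poly ?B z * (\<Sum>l\<in>Z. ?w l * (1 + (- 2 * l / (l - z))))"
    by (simp only: distrib_left sum.distrib mult_1_right)
  also have "(\<Sum>l\<in>Z. ?w l * (1 + (- 2 * l / (l - z)))) = (\<Sum>l\<in>Z. - (?w l * ((l + z) / (l - z))))"
  proof (rule sum.cong[OF refl])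
    fix l assume "l \<in> Z"
    then have "l \<noteq> z" using z by (auto simp: Z_def)
    then have "1 + (- 2 * l / (l - z)) = - ((l + z) / (l - z))"
      by (simp add: field_simps)
    then show "?w l * (1 + (- 2 * l / (l - z))) = - (?w l * ((l + z) / (l - z)))"
      by (metis mult_minus_right)
  qed
  finally show ?thesis
    using z by (simp add: mod_approximant_def sum_negf)
qed


section \<open>Measures on the unit circle and their supports\<close>

locale circle_measure = prob_space \<mu> for \<mu> :: "complex measure" +
  assumes sets_circle: "sets \<mu> = sets (restrict_space borel \<T>)"
begin

lemma space_circle: "space \<mu> = \<T>"
  using sets_eq_imp_space_eq[OF sets_circle] by (simp add: space_restrict_space)

lemma integrable_circle:
  fixes f :: "complex \<Rightarrow> 'b::{banach, second_countable_topology}"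
  assumes "continuous_on \<T> f"
  shows "integrable \<mu> f"
proof -
  have meas: "f \<in> borel_measurable \<mu>"
    using borel_measurable_continuous_on_restrict[OF assms]
    by (simp add: measurable_cong_sets[OF sets_circle refl])
  have "bounded (f ` \<T>)"
    using assms by (intro compact_imp_bounded compact_continuous_image) auto
  then obtain B where "\<And>w. w \<in> \<T> \<Longrightarrow> norm (f w) \<le> B"
    unfolding bounded_iff by blast
  then show ?thesis
    using meas by (intro integrable_const_bound[where B = B]) (auto intro!: AE_I2 simp: space_circle)
qed

lemma integral_circle_cong:
  assumes "\<And>w. cmod w = 1 \<Longrightarrow> f w = g w"
  shows "integral\<^sup>L \<mu> f = integral\<^sup>L \<mu> g"
  using assms by (intro Bochner_Integration.integral_cong) (auto simp: space_circle)

lemma measure_supp_subset: "measure_supp \<mu> \<subseteq> \<T>"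
  by (auto simp: measure_supp_def space_circle)

lemma closed_measure_supp: "closed (measure_supp \<mu>)"
  unfolding closed_def
proof (subst open_subopen, intro ballI)
  fix x assume x: "x \<in> - measure_supp \<mu>"
  show "\<exists>T. open T \<and> x \<in> T \<and> T \<subseteq> - measure_supp \<mu>"
  proof (cases "x \<in> \<T>")
    case True
    then obtain U where "open U" "x \<in> U" "\<not> emeasure \<mu> (U \<inter> space \<mu>) > 0"
      using x by (auto simp: measure_supp_def space_circle)
    then show ?thesis by (intro exI[of _ U]) (auto simp: measure_supp_def)
  next
    case False
    then show ?thesis
      using measure_supp_subset by (intro exI[of _ "- \<T>"]) auto
  qed
qed

text \<open>Countably many null open sets suffice to cover the complement of the support, by the
  Lindelof property of the plane.\<close>

lemma AE_in_measure_supp: "AE w in \<mu>. w \<in> measure_supp \<mu>"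
proof -
  define F where "F = {U. open U \<and> emeasure \<mu> (U \<inter> space \<mu>) = 0}"
  obtain F' where F': "F' \<subseteq> F" "countable F'" "\<Union>F' = \<Union>F"
    using Lindelof[of F] by (auto simp: F_def)
  have "U \<inter> space \<mu> \<in> sets \<mu>" if "open U" for U
    using that unfolding sets_circle space_circle
    by (subst sets_restrict_space_iff) auto
  then have "U \<inter> space \<mu> \<in> null_sets \<mu>" if "U \<in> F'" for U
    using that F' by (auto simp: F_def null_sets_def)
  then have "(\<Union>U\<in>F'. U \<inter> space \<mu>) \<in> null_sets \<mu>"
    using F' by (intro null_sets_UN') auto
  moreover have "{w \<in> space \<mu>. w \<notin> measure_supp \<mu>} \<subseteq> (\<Union>U\<in>F'. U \<inter> space \<mu>)"
  proof
    fix w assume w: "w \<in> {w \<in> space \<mu>. w \<notin> measure_supp \<mu>}"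
    then obtain U where "open U" "w \<in> U" "\<not> emeasure \<mu> (U \<inter> space \<mu>) > 0"
      by (auto simp: measure_supp_def)
    then have "w \<in> \<Union>F" by (auto simp: F_def)
    then show "w \<in> (\<Union>U\<in>F'. U \<inter> space \<mu>)" using F' w by auto
  qed
  ultimately show ?thesis by (rule AE_I')
qed

lemma AE_zero_imp_zero_on_supp:
  fixes f :: "complex \<Rightarrow> 'b::{real_normed_vector, second_countable_topology}"
  assumes f: "continuous_on \<T> f" and ae: "AE w in \<mu>. f w = 0" and x: "x \<in> measure_supp \<mu>"
  shows "f x = 0"
proof (rule ccontr)
  assume "f x \<noteq> 0"
  have "openin (top_of_set \<T>) (\<T> \<inter> f -` (- {0}))"
    using f by (intro continuous_openin_preimage_gen) auto
  then obtain U where U: "open U" "\<T> \<inter> f -` (- {0}) = \<T> \<inter> U"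
    by (auto simp: openin_open)
  have "x \<in> U" using x measure_supp_subset \<open>f x \<noteq> 0\<close> U by auto
  then have pos: "emeasure \<mu> (U \<inter> space \<mu>) > 0"
    using x U(1) unfolding measure_supp_def by blast
  have "AE w in \<mu>. w \<notin> U \<inter> space \<mu>"
    using ae
  proof (rule AE_mp, intro AE_I2 impI)
    fix w assume "w \<in> space \<mu>" "f w = 0"
    then show "w \<notin> U \<inter> space \<mu>"
      unfolding space_circle using U(2) by blast
  qed
  moreover have "U \<inter> space \<mu> \<in> sets \<mu>"
    using U(1) unfolding sets_circle space_circle by (subst sets_restrict_space_iff) auto
  ultimately have "emeasure \<mu> (U \<inter> space \<mu>) = 0"
    by (subst (asm) AE_iff_measurable[of "U \<inter> space \<mu>"]) auto
  with pos show False by simp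
qed


section \<open>The inner product on polynomials\<close>

definition ip :: "complex poly \<Rightarrow> complex poly \<Rightarrow> complex" where
  "ip p q = (LINT w|\<mu>. poly p w * cnj (poly q w))"

lemma integrable_ip: "integrable \<mu> (\<lambda>w. poly p w * cnj (poly q w))"
  by (intro integrable_circle continuous_intros)

lemma ip_add_left: "ip (p + q) r = ip p r + ip q r"
  and ip_diff_left: "ip (p - q) r = ip p r - ip q r"
  and ip_smult_left: "ip (smult c p) r = c * ip p r"
  and ip_0_left [simp]: "ip 0 r = 0"
  using integrable_ip[of p r] integrable_ip[of q r]
  by (simp_all add: ip_def algebra_simps)

lemma cnj_ip: "cnj (ip p r) = ip r p"
  unfolding ip_def by (subst Bochner_Integration.integral_cnj[symmetric]) (simp add: mult.commute)

lemma ip_add_right: "ip r (p + q) = ip r p + ip r q"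
  and ip_diff_right: "ip r (p - q) = ip r p - ip r q"
  and ip_smult_right: "ip r (smult c p) = cnj c * ip r p"
  and ip_0_right [simp]: "ip r 0 = 0"
  by (simp_all only: cnj_ip[of _ r, symmetric] ip_add_left ip_diff_left ip_smult_left ip_0_left
      complex_cnj_add complex_cnj_diff complex_cnj_mult complex_cnj_zero)

lemma ip_sum_left: "ip (sum f A) r = (\<Sum>i\<in>A. ip (f i) r)"
  by (induction A rule: infinite_finite_induct) (simp_all add: ip_add_left)

lemma ip_sum_right: "ip r (sum f A) = (\<Sum>i\<in>A. ip r (f i))"
  by (induction A rule: infinite_finite_induct) (simp_all add: ip_add_right)

lemma ip_self: "ip p p = of_real (LINT w|\<mu>. (cmod (poly p w))\<^sup>2)"
  unfolding ip_def complex_norm_square[symmetric] by (rule integral_complex_of_real)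

lemma ip_pCons_0: "ip (pCons 0 p) (pCons 0 q) = ip p q"
proof -
  have "w * x * cnj (w * y) = x * cnj y" if "cmod w = 1" for w x y
  proof -
    have "w * cnj w = 1" using that by (simp add: complex_norm_square[symmetric])
    then show ?thesis by (simp only: complex_cnj_mult) algebra
  qed
  then show ?thesis
    unfolding ip_def by (intro integral_circle_cong) simp
qed

lemma ip_star_self: "ip (star_poly p) (star_poly p) = ip p p"
proof -
  have "cmod (poly (star_poly p) w) = cmod (poly p w)" if "cmod w = 1" for w
    using that by (simp add: poly_star_poly_circle norm_mult norm_power)
  then have "(LINT w|\<mu>. (cmod (poly (star_poly p) w))\<^sup>2) = (LINT w|\<mu>. (cmod (poly p w))\<^sup>2)"
    by (intro integral_circle_cong) simp
  then show ?thesis by (simp add: ip_self)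
qed

text \<open>With \<open>n = degree p\<close>, on the circle \<open>p\<^sup>* = w\<^sup>n cnj p\<close> and \<open>cnj w = 1 / w\<close>. The factor \<open>w\<^sup>n\<close>
  turns the conjugate of \<open>w q(w)\<close> into a polynomial of degree less than \<open>n\<close>, and \<open>cnj p\<close>
  remains as the second factor of an inner product.\<close>

lemma ip_star_pCons_0:
  assumes "degree q < degree p"
  shows "ip (star_poly p) (pCons 0 q) = ip (monom 1 (degree p - 1 - degree q) * star_poly q) p"
  unfolding ip_def
proof (rule integral_circle_cong)
  fix w :: complex assume w: "cmod w = 1"
  have ww: "w * cnj w = 1" using w by (simp add: complex_norm_square[symmetric])
  have "degree p = Suc (degree p - 1 - degree q + degree q)" using assms by simp
  then have "w ^ degree p = w * (w ^ (degree p - 1 - degree q) * w ^ degree q)"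
    by (metis power_Suc power_add)
  then have "w ^ degree p * cnj w = w * cnj w * (w ^ (degree p - 1 - degree q) * w ^ degree q)"
    by (simp only: mult_ac)
  then have *: "w ^ degree p * cnj w = w ^ (degree p - 1 - degree q) * w ^ degree q"
    by (simp only: ww mult_1_left)
  have "poly (star_poly p) w * cnj (poly (pCons 0 q) w) =
      (w ^ degree p * cnj w) * (cnj (poly p w) * cnj (poly q w))"
    by (simp add: poly_star_poly_circle[OF w] mult_ac)
  then show "poly (star_poly p) w * cnj (poly (pCons 0 q) w) =
      poly (monom 1 (degree p - 1 - degree q) * star_poly q) w * cnj (poly p w)"
    unfolding * by (simp add: poly_star_poly_circle[OF w] poly_monom mult_ac)
qed

lemma ip_self_eq_0_imp:
  assumes "infinite (measure_supp \<mu>)" and "ip p p = 0"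
  shows "p = 0"
proof (rule ccontr)
  assume "p \<noteq> 0"
  have cont: "continuous_on \<T> (\<lambda>w. (cmod (poly p w))\<^sup>2)"
    by (intro continuous_intros)
  have "(LINT w|\<mu>. (cmod (poly p w))\<^sup>2) = 0"
    using assms(2) by (simp add: ip_self)
  then have "AE w in \<mu>. (cmod (poly p w))\<^sup>2 = 0"
    by (subst (asm) integral_nonneg_eq_0_iff_AE[OF integrable_circle[OF cont]]) auto
  then have "measure_supp \<mu> \<subseteq> {w. poly p w = 0}"
    using AE_zero_imp_zero_on_supp[OF cont] by auto
  then show False
    using assms(1) poly_roots_finite[OF \<open>p \<noteq> 0\<close>] finite_subset by blast
qed

end


section \<open>Orthogonal polynomials satisfy the Szego recurrence\<close>

locale szego_measure = circle_measure +
  fixes a :: "nat \<Rightarrow> complex"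
  assumes infinite_supp: "infinite (measure_supp \<mu>)"
    and schur: "schur_parameters \<mu> a"
begin

lemma monic_orthogonal_degree:
  assumes "monic_orthogonal_polys \<mu> \<Phi>"
  shows "degree (\<Phi> n) = n" and "coeff (\<Phi> n) n = 1"
proof -
  show d: "degree (\<Phi> n) = n"
    using assms unfolding monic_orthogonal_polys_def by blast
  have "lead_coeff (\<Phi> n) = 1"
    using assms unfolding monic_orthogonal_polys_def by blast
  then show "coeff (\<Phi> n) n = 1" unfolding d .
qed

lemma monic_orthogonal_ip_lower:
  assumes \<Phi>: "monic_orthogonal_polys \<mu> \<Phi>" and "degree q < n"
  shows "ip (\<Phi> n) q = 0"
  using assms(2)
proof (induction "degree q" arbitrary: q rule: less_induct)
  case less
  let ?d = "degree q"
  let ?r = "q - smult (lead_coeff q) (\<Phi> ?d)"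
  have \<Phi>d: "degree (\<Phi> ?d) = ?d" "coeff (\<Phi> ?d) ?d = 1"
    by (rule monic_orthogonal_degree[OF \<Phi>])+
  have ort: "ip (\<Phi> n) (\<Phi> ?d) = 0"
    using \<Phi> less.prems unfolding monic_orthogonal_polys_def ip_def by auto
  have "degree ?r \<le> ?d"
    using \<Phi>d by (intro degree_diff_le order_trans[OF degree_smult_le]) auto
  then have "?r = 0 \<or> degree ?r < ?d"
    using \<Phi>d by (intro eq_zero_or_degree_less) auto
  then have "ip (\<Phi> n) ?r = 0"
  proof
    assume "?r = 0"
    then show ?thesis by (simp only: ip_0_right)
  next
    assume "degree ?r < ?d"
    then show ?thesis
      using less.prems by (intro less.hyps) linarith+
  qed
  then show ?case
    using ort by (simp add: ip_diff_right ip_smult_right)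
qed

text \<open>The defect \<open>Q\<close> in the recurrence vanishes at \<open>0\<close> and has degree at most \<open>n\<close>, so
  \<open>Q = z q\<close> with \<open>degree q < n\<close>; each of its three terms is orthogonal to all such
  polynomials \<open>z q\<close>, so \<open>Q\<close> is orthogonal to itself.\<close>

lemma Phi_poly_unique:
  assumes \<Phi>: "monic_orthogonal_polys \<mu> \<Phi>" and a: "\<forall>n\<ge>1. a n = poly (\<Phi> n) 0"
  shows "\<Phi> n = Phi_poly a n"
proof (induction n)
  case 0
  have "degree (\<Phi> 0) = 0" "coeff (\<Phi> 0) 0 = 1"
    by (rule monic_orthogonal_degree[OF \<Phi>])+
  then show ?case by (metis Phi_poly.simps(1) degree_0_id of_nat_1 one_pCons)
next
  case (Suc n)
  have \<Phi>S: "degree (\<Phi> (Suc n)) = Suc n" "coeff (\<Phi> (Suc n)) (Suc n) = 1"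
    by (rule monic_orthogonal_degree[OF \<Phi>])+
  define Q where "Q = \<Phi> (Suc n) - Phi_poly a (Suc n)"
  have "coeff Q 0 = 0"
    using a by (simp add: Q_def coeff_star_poly poly_0_coeff_0 Phi_poly.simps(2))
  then obtain q where q: "Q = pCons 0 q" by (metis coeff_pCons_0 pCons_cases)
  have "degree Q \<le> Suc n"
    unfolding Q_def using \<Phi>S by (intro degree_diff_le) simp_all
  moreover have "coeff Q (Suc n) = 0"
    using \<Phi>S unfolding Q_def by simp
  ultimately have "Q = 0 \<or> degree Q < Suc n"
    by (intro eq_zero_or_degree_less)
  moreover have "ip Q Q = 0" if "q \<noteq> 0" "degree Q < Suc n"
  proof -
    have dq: "degree q < n" using that q by simp
    then have "ip (star_poly (Phi_poly a n)) (pCons 0 q)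
        = ip (monom 1 (n - 1 - degree q) * star_poly q) (Phi_poly a n)"
      using ip_star_pCons_0[of q "Phi_poly a n"] by simp
    moreover have "degree (monom 1 (n - 1 - degree q) * star_poly q) < n"
      using degree_mult_le[of "monom 1 (n - 1 - degree q)" "star_poly q"]
        degree_monom_le[of "1::complex" "n - 1 - degree q"] degree_star_poly_le[of q] dq
      by linarith
    then have "ip (Phi_poly a n) (monom 1 (n - 1 - degree q) * star_poly q) = 0"
      unfolding Suc[symmetric] by (rule monic_orthogonal_ip_lower[OF \<Phi>])
    ultimately have 1: "ip (star_poly (Phi_poly a n)) (pCons 0 q) = 0"
      by (metis cnj_ip complex_cnj_zero)
    have 2: "ip (Phi_poly a n) q = 0"
      unfolding Suc[symmetric] by (rule monic_orthogonal_ip_lower[OF \<Phi> dq])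
    have 3: "ip (\<Phi> (Suc n)) (pCons 0 q) = 0"
      using dq by (intro monic_orthogonal_ip_lower[OF \<Phi>]) (auto simp: degree_pCons_eq_if)
    have "ip Q (pCons 0 q) = 0"
      by (simp add: Q_def Phi_poly.simps(2) ip_diff_left ip_add_left ip_smult_left ip_pCons_0 1 2 3)
    then show ?thesis by (simp add: q)
  qed
  ultimately have "Q = 0"
    using ip_self_eq_0_imp[OF infinite_supp, of Q] q by (cases "q = 0") auto
  then show ?case by (simp add: Q_def)
qed

lemma monic_orthogonal_Phi_poly: "monic_orthogonal_polys \<mu> (Phi_poly a)"
proof -
  obtain \<Phi> where \<Phi>: "monic_orthogonal_polys \<mu> \<Phi>" "\<forall>n\<ge>1. a n = poly (\<Phi> n) 0"
    using schur unfolding schur_parameters_def by blast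
  have "\<Phi> = Phi_poly a"
    by (rule ext) (rule Phi_poly_unique[OF \<Phi>])
  with \<Phi>(1) show ?thesis by simp
qed

lemma ip_Phi_lower: "degree q < n \<Longrightarrow> ip (Phi_poly a n) q = 0"
  by (rule monic_orthogonal_ip_lower[OF monic_orthogonal_Phi_poly])

text \<open>Pythagoras in \<open>z \<Phi>\<^sub>n = \<Phi>\<^sub>n\<^sub>+\<^sub>1 - a\<^sub>n\<^sub>+\<^sub>1 \<Phi>\<^sub>n\<^sup>*\<close>, where the terms on the right are
  orthogonal.\<close>

lemma ip_Phi_Suc_self:
  "ip (Phi_poly a (Suc n)) (Phi_poly a (Suc n)) =
     of_real (1 - (cmod (a (Suc n)))\<^sup>2) * ip (Phi_poly a n) (Phi_poly a n)"
proof -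
  let ?P = "Phi_poly a (Suc n)" and ?S = "star_poly (Phi_poly a n)" and ?\<alpha> = "a (Suc n)"
  have zP: "pCons 0 (Phi_poly a n) = ?P - smult ?\<alpha> ?S" by (simp add: Phi_poly.simps(2))
  have PS: "ip ?P ?S = 0"
    using degree_star_Phi_poly_le[of a n] by (intro ip_Phi_lower) simp
  then have SP: "ip ?S ?P = 0" by (metis cnj_ip complex_cnj_zero)
  have "ip (Phi_poly a n) (Phi_poly a n) = ip (?P - smult ?\<alpha> ?S) (?P - smult ?\<alpha> ?S)"
    by (metis ip_pCons_0 zP)
  also have "\<dots> = ip ?P ?P + ?\<alpha> * cnj ?\<alpha> * ip ?S ?S"
    by (simp add: ip_diff_left ip_diff_right ip_smult_left ip_smult_right PS SP algebra_simps)
  finally have "ip (Phi_poly a n) (Phi_poly a n) =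
      ip ?P ?P + ?\<alpha> * cnj ?\<alpha> * ip (Phi_poly a n) (Phi_poly a n)"
    by (simp only: ip_star_self)
  moreover have "of_real (1 - (cmod ?\<alpha>)\<^sup>2) = 1 - ?\<alpha> * cnj ?\<alpha>"
    by (simp only: of_real_diff of_real_1 complex_norm_square)
  ultimately show ?thesis by algebra
qed

lemma ip_Phi_self: "ip (Phi_poly a n) (Phi_poly a n) = of_real (szego_norm a n)"
proof (induction n)
  case 0
  show ?case by (simp add: ip_def prob_space)
next
  case (Suc n)
  then show ?case by (simp only: ip_Phi_Suc_self szego_norm_Suc of_real_mult)
qed

lemma szego_norm_positive: "szego_norm a n > 0"
proof -
  have "szego_norm a n = (LINT w|\<mu>. (cmod (poly (Phi_poly a n) w))\<^sup>2)"
    using ip_Phi_self[of n] unfolding ip_self of_real_eq_iff by simp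
  then have "szego_norm a n \<ge> 0" by simp
  moreover have "szego_norm a n \<noteq> 0"
    using ip_self_eq_0_imp[OF infinite_supp, of "Phi_poly a n"] coeff_Phi_poly_degree[of a n]
    by (metis coeff_0 ip_Phi_self of_real_0 zero_neq_one)
  ultimately show ?thesis by simp
qed

lemma schur_parameter_less_1: "\<forall>k\<ge>1. cmod (a k) < 1"
proof (intro allI impI)
  fix k :: nat assume "k \<ge> 1"
  then obtain n where k: "k = Suc n" by (cases k) auto
  have "(1 - (cmod (a k))\<^sup>2) * szego_norm a n > 0"
    using szego_norm_positive[of k] by (simp add: k szego_norm_Suc)
  then have "(cmod (a k))\<^sup>2 < 1"
    using szego_norm_positive[of n] by (simp add: zero_less_mult_iff)
  then show "cmod (a k) < 1" by (simp add: abs_square_less_1)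
qed

lemma ip_Phi_Phi:
  "ip (Phi_poly a k) (Phi_poly a l) = (if k = l then of_real (szego_norm a k) else 0)"
  using monic_orthogonal_Phi_poly ip_Phi_self by (auto simp: monic_orthogonal_polys_def ip_def)

lemma ip_1_right: "ip p 1 = (LINT w|\<mu>. poly p w)"
  by (simp add: ip_def)

lemma ip_cd_poly_1: "ip (cd_poly a (Suc m) l) 1 = 1"
proof -
  have "ip (cd_poly a (Suc m) l) (Phi_poly a 0) = (\<Sum>k<Suc m. if k = 0 then 1 else 0)"
    unfolding cd_poly_def ip_sum_left ip_smult_left ip_Phi_Phi by (intro sum.cong) auto
  then show ?thesis by simp
qed

lemma cd_poly_norm: "(LINT w|\<mu>. (cmod (poly (cd_poly a n l) w))\<^sup>2) = cd_diag a n l"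
proof -
  have h: "complex_of_real (szego_norm a k) \<noteq> 0" for k
    using szego_norm_positive[of k] by simp
  have *: "ip (Phi_poly a k) (cd_poly a n l) = poly (Phi_poly a k) l" if "k < n" for k
  proof -
    have "ip (Phi_poly a k) (cd_poly a n l) = (\<Sum>j<n. if j = k then poly (Phi_poly a k) l else 0)"
      unfolding cd_poly_def ip_sum_right ip_smult_right ip_Phi_Phi using h by (intro sum.cong) auto
    with that show ?thesis by simp
  qed
  have "ip (cd_poly a n l) (cd_poly a n l) =
      (\<Sum>k<n. cnj (poly (Phi_poly a k) l) / of_real (szego_norm a k) * ip (Phi_poly a k) (cd_poly a n l))"
    by (subst cd_poly_def) (simp add: ip_sum_left ip_smult_left)
  also have "\<dots> = poly (cd_poly a n l) l"
    unfolding poly_cd_poly by (intro sum.cong) (simp_all add: * mult.commute)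
  finally have "complex_of_real (LINT w|\<mu>. (cmod (poly (cd_poly a n l) w))\<^sup>2) = of_real (cd_diag a n l)"
    by (simp only: ip_self poly_cd_poly_diag)
  then show ?thesis by (simp only: of_real_eq_iff)
qed

end


section \<open>The quadrature formula and weak convergence\<close>

text \<open>Since \<open>cnj w = 1 / w\<close> on the circle, these are the restrictions of the Laurent
  polynomials.\<close>

definition trig_polynomial :: "(complex \<Rightarrow> complex) \<Rightarrow> bool" where
  "trig_polynomial g \<longleftrightarrow> (\<exists>N p. \<forall>w\<in>\<T>. g w = cnj w ^ N * poly p w)"

lemma trig_polynomialI:
  "(\<And>w. cmod w = 1 \<Longrightarrow> g w = cnj w ^ N * poly p w) \<Longrightarrow> trig_polynomial g"
  unfolding trig_polynomial_def by (intro exI[of _ N] exI[of _ p]) auto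

lemma trig_polynomial_continuous: "trig_polynomial g \<Longrightarrow> continuous_on \<T> g"
  unfolding trig_polynomial_def
  by (elim exE, subst continuous_on_cong[OF refl]) (auto intro!: continuous_intros)

lemma trig_polynomial_const: "trig_polynomial (\<lambda>w. c)"
  by (rule trig_polynomialI[of _ 0 "[:c:]"]) simp

lemma trig_polynomial_add:
  assumes "trig_polynomial f" "trig_polynomial g"
  shows "trig_polynomial (\<lambda>w. f w + g w)"
proof -
  obtain M p N q where f: "\<forall>w\<in>\<T>. f w = cnj w ^ M * poly p w" and g: "\<forall>w\<in>\<T>. g w = cnj w ^ N * poly q w"
    using assms unfolding trig_polynomial_def by blast
  show ?thesis
  proof (rule trig_polynomialI[of _ "M + N" "monom 1 N * p + monom 1 M * q"])
    fix w :: complex assume w: "cmod w = 1"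
    have "cnj w ^ k * w ^ k = 1" for k
      using circle_inverse[OF w] by (metis mult.commute power_mult_distrib power_one)
    then have *: "cnj w ^ k * (w ^ k * x) = x" for k x
      by (metis mult.assoc mult_1)
    have "cnj w ^ (M + N) * poly (monom 1 N * p + monom 1 M * q) w =
        cnj w ^ M * (cnj w ^ N * (w ^ N * poly p w)) + cnj w ^ N * (cnj w ^ M * (w ^ M * poly q w))"
      by (simp add: poly_monom power_add distrib_left mult_ac)
    then show "f w + g w = cnj w ^ (M + N) * poly (monom 1 N * p + monom 1 M * q) w"
      using f g w by (simp only: *) simp
  qed
qed

lemma trig_polynomial_mult:
  assumes "trig_polynomial f" "trig_polynomial g"
  shows "trig_polynomial (\<lambda>w. f w * g w)"
proof -
  obtain M p N q where f: "\<forall>w\<in>\<T>. f w = cnj w ^ M * poly p w" and g: "\<forall>w\<in>\<T>. g w = cnj w ^ N * poly q w"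
    using assms unfolding trig_polynomial_def by blast
  show ?thesis
    by (rule trig_polynomialI[of _ "M + N" "p * q"]) (use f g in \<open>simp add: power_add\<close>)
qed

lemma trig_polynomial_real_polynomial_function:
  fixes f :: "complex \<Rightarrow> real"
  assumes "real_polynomial_function f"
  shows "trig_polynomial (\<lambda>w. of_real (f w))"
  using assms
proof (induction rule: real_polynomial_function.induct)
  case (linear f)
  interpret bounded_linear f by fact
  show ?case
    \<comment> \<open>\<open>f w\<close> is a combination of \<open>cnj w\<close> and \<open>w = cnj w * w\<^sup>2\<close>, because \<open>Re w\<close> and \<open>Im w\<close> are.\<close>
  proof (rule trig_polynomialI[of _ 1 "[:(f 1 + \<i> * f \<i>) / 2, 0, (f 1 - \<i> * f \<i>) / 2:]"])
    fix w :: complex assume "cmod w = 1"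
    then have *: "w * cnj w = 1" by (rule circle_inverse)
    have "f w = f (Re w *\<^sub>R 1 + Im w *\<^sub>R \<i>)"
      by (rule arg_cong[of _ _ f]) (simp add: complex_eq_iff)
    also have "\<dots> = Re w * f 1 + Im w * f \<i>"
      by (simp only: add scaleR real_scaleR_def)
    finally have "complex_of_real (f w) = of_real (Re w) * of_real (f 1) + of_real (Im w) * of_real (f \<i>)"
      by simp
    also have "of_real (Re w) = (w + cnj w) / 2"
      by (simp add: complex_add_cnj)
    also have "of_real (Im w) = (w - cnj w) / (2 * \<i>)"
      by (simp add: complex_diff_cnj complex_eq_iff)
    also have "(w + cnj w) / 2 * of_real (f 1) + (w - cnj w) / (2 * \<i>) * of_real (f \<i>) =
        (w + cnj w) / 2 * of_real (f 1) + \<i> * (cnj w - w) / 2 * of_real (f \<i>)"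
      by (simp add: field_simps)
    also have "\<dots> = cnj w * ((f 1 + \<i> * f \<i>) / 2) + (w * cnj w) * w * ((f 1 - \<i> * f \<i>) / 2)"
      unfolding * by (simp add: field_simps)
    also have "\<dots> = cnj w ^ 1 * poly [:(f 1 + \<i> * f \<i>) / 2, 0, (f 1 - \<i> * f \<i>) / 2:] w"
      by (simp add: algebra_simps)
    finally show "complex_of_real (f w) =
      cnj w ^ 1 * poly [:(f 1 + \<i> * f \<i>) / 2, 0, (f 1 - \<i> * f \<i>) / 2:] w" .
  qed
next
  case (const c)
  show ?case by (rule trig_polynomial_const)
next
  case (add f g)
  then show ?case using trig_polynomial_add by fastforce
next
  case (mult f g)
  then show ?case using trig_polynomial_mult by fastforce
qed

lemma trig_polynomial_dense:
  assumes g: "continuous_on \<T> g" and e: "e > 0"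
  obtains h where "trig_polynomial h" "\<And>w. cmod w = 1 \<Longrightarrow> cmod (g w - h w) < e"
proof -
  obtain h where h: "polynomial_function h" "\<And>w. w \<in> \<T> \<Longrightarrow> cmod (g w - h w) < e"
    using Stone_Weierstrass_polynomial_function[OF compact_sphere g e] by blast
  have "real_polynomial_function (\<lambda>w. Re (h w))" "real_polynomial_function (\<lambda>w. Im (h w))"
    using h(1) bounded_linear_Re bounded_linear_Im by (auto simp: polynomial_function_def o_def)
  then have "trig_polynomial (\<lambda>w. of_real (Re (h w)) + \<i> * of_real (Im (h w)))"
    by (intro trig_polynomial_add trig_polynomial_mult trig_polynomial_const
        trig_polynomial_real_polynomial_function)
  then have "trig_polynomial h" by (simp add: complex_eq[symmetric])
  with h(2) show ?thesis by (intro that) auto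
qed

context szego_measure
begin

text \<open>The quadrature functional: nodes at the zeros of the para-orthogonal polynomial, weights
  \<open>1 / K\<^sub>n(l, l)\<close>.\<close>

definition quad :: "complex \<Rightarrow> nat \<Rightarrow> (complex \<Rightarrow> complex) \<Rightarrow> complex" where
  "quad v n g = (\<Sum>l | poly (Phi_para a v n) l = 0. of_real (1 / cd_diag a n l) * g l)"

lemma quad_cong:
  assumes "cmod v = 1" and "\<And>w. cmod w = 1 \<Longrightarrow> f w = g w"
  shows "quad v (Suc m) f = quad v (Suc m) g"
  unfolding quad_def
  using Phi_para_zero_on_circle[OF schur_parameter_less_1 assms(1)] assms(2)
  by (intro sum.cong) auto

lemma quad_diff: "quad v n (\<lambda>w. f w - g w) = quad v n f - quad v n g"
  by (simp add: quad_def right_diff_distrib sum_subtractf)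

lemma quad_sum: "quad v n (\<lambda>w. \<Sum>i\<in>A. f i w) = (\<Sum>i\<in>A. quad v n (f i))"
  unfolding quad_def sum_distrib_left by (rule sum.swap)

lemma quad_mult: "quad v n (\<lambda>w. c * g w) = c * quad v n g"
  by (simp add: quad_def sum_distrib_left mult_ac)

lemma quad_cnj: "quad v n (\<lambda>w. cnj (g w)) = cnj (quad v n g)"
  by (simp add: quad_def)

text \<open>It suffices to test the formula on the Lagrange basis, and there it says that the
  kernel integrates to \<open>1\<close>.\<close>

lemma quad_poly:
  assumes v: "cmod v = 1" and p: "degree p \<le> m"
  shows "quad v (Suc m) (poly p) = (LINT w|\<mu>. poly p w)"
proof -
  define Z where "Z = {z. poly (Phi_para a v (Suc m)) z = 0}"
  have "ip p 1 = ip (\<Sum>l\<in>Z. smult (poly p l / of_real (cd_diag a (Suc m) l)) (cd_poly a (Suc m) l)) 1"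
    unfolding Z_def using lagrange_interpolation_Phi_para_zeros[OF schur_parameter_less_1 v p] by simp
  also have "\<dots> = (\<Sum>l\<in>Z. poly p l / of_real (cd_diag a (Suc m) l))"
    by (simp add: ip_sum_left ip_smult_left ip_cd_poly_1)
  finally show ?thesis
    by (simp add: quad_def Z_def ip_1_right)
qed

lemma quad_mass:
  assumes "cmod v = 1"
  shows "(\<Sum>l | poly (Phi_para a v (Suc m)) l = 0. 1 / cd_diag a (Suc m) l) = 1"
proof -
  have "poly 1 = (\<lambda>w. 1 :: complex)" by (simp add: fun_eq_iff)
  then have "quad v (Suc m) (poly 1) = 1"
    using quad_poly[OF assms, of 1 m] by (simp add: prob_space)
  then have "complex_of_real (\<Sum>l | poly (Phi_para a v (Suc m)) l = 0. 1 / cd_diag a (Suc m) l) = of_real 1"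
    by (simp add: quad_def)
  then show ?thesis by (simp only: of_real_eq_iff)
qed

lemma quad_norm_le:
  assumes v: "cmod v = 1" and g: "\<And>w. cmod w = 1 \<Longrightarrow> cmod (g w) \<le> B"
  shows "cmod (quad v (Suc m) g) \<le> B"
proof -
  have "cmod (quad v (Suc m) g) \<le>
      (\<Sum>l | poly (Phi_para a v (Suc m)) l = 0. 1 / cd_diag a (Suc m) l * B)"
    unfolding quad_def
  proof (rule sum_norm_le)
    fix l assume "l \<in> {l. poly (Phi_para a v (Suc m)) l = 0}"
    then have "cmod l = 1"
      using Phi_para_zero_on_circle[OF schur_parameter_less_1 v] by simp
    then have "cmod (g l) \<le> B" by (rule g)
    moreover have "0 \<le> 1 / cd_diag a (Suc m) l"
      using cd_diag_Suc_ge_1[OF schur_parameter_less_1, of m l] by simp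
    ultimately show "cmod (of_real (1 / cd_diag a (Suc m) l) * g l) \<le> 1 / cd_diag a (Suc m) l * B"
      unfolding norm_mult norm_of_real by (metis abs_of_nonneg mult_left_mono)
  qed
  also have "\<dots> = B"
    unfolding sum_distrib_right[symmetric] quad_mass[OF v] by simp
  finally show ?thesis .
qed

text \<open>Nonnegative powers of \<open>w\<close> are polynomials; the negative ones follow by conjugation,
  because the weights are real.\<close>

lemma quad_monomial:
  assumes v: "cmod v = 1" and "j \<le> m" "k \<le> m"
  shows "quad v (Suc m) (\<lambda>w. cnj w ^ k * w ^ j) = (LINT w|\<mu>. cnj w ^ k * w ^ j)"
proof -
  have *: "quad v (Suc m) (\<lambda>w. cnj w ^ k * w ^ j) = (LINT w|\<mu>. cnj w ^ k * w ^ j)"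
    if "k \<le> j" "j \<le> m" for j k
  proof -
    have eq: "cnj w ^ k * w ^ j = poly (monom 1 (j - k)) w" if "cmod w = 1" for w
    proof -
      have "w ^ j = w ^ k * w ^ (j - k)" using \<open>k \<le> j\<close> by (simp flip: power_add)
      then have "cnj w ^ k * w ^ j = (w * cnj w) ^ k * w ^ (j - k)"
        by (simp add: power_mult_distrib)
      then show ?thesis by (simp add: circle_inverse[OF that] poly_monom)
    qed
    have "quad v (Suc m) (\<lambda>w. cnj w ^ k * w ^ j) = quad v (Suc m) (poly (monom 1 (j - k)))"
      using eq by (rule quad_cong[OF v])
    also have "\<dots> = (LINT w|\<mu>. poly (monom 1 (j - k)) w)"
      using that by (intro quad_poly[OF v] order_trans[OF degree_monom_le]) simp
    also have "\<dots> = (LINT w|\<mu>. cnj w ^ k * w ^ j)"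
      using eq by (intro integral_circle_cong) simp
    finally show ?thesis .
  qed
  show ?thesis
  proof (cases "k \<le> j")
    case True
    then show ?thesis using * assms by simp
  next
    case False
    have "quad v (Suc m) (\<lambda>w. cnj w ^ k * w ^ j) = quad v (Suc m) (\<lambda>w. cnj (cnj w ^ j * w ^ k))"
      by (simp add: mult.commute)
    also have "\<dots> = cnj (LINT w|\<mu>. cnj w ^ j * w ^ k)"
      unfolding quad_cnj using * False assms by simp
    also have "\<dots> = (LINT w|\<mu>. cnj w ^ k * w ^ j)"
      by (subst Bochner_Integration.integral_cnj[symmetric]) (simp add: mult.commute)
    finally show ?thesis .
  qed
qed

lemma quad_trig_polynomial:
  assumes "trig_polynomial g"
  obtains M where "\<And>m v. M \<le> m \<Longrightarrow> cmod v = 1 \<Longrightarrow> quad v (Suc m) g = (LINT w|\<mu>. g w)"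
proof -
  obtain N p where g: "\<forall>w\<in>\<T>. g w = cnj w ^ N * poly p w"
    using assms by (auto simp: trig_polynomial_def)
  have eq: "g w = (\<Sum>j\<le>degree p. coeff p j * (cnj w ^ N * w ^ j))" if "cmod w = 1" for w
    using g that by (simp add: poly_altdef sum_distrib_left mult_ac)
  have "quad v (Suc m) g = (LINT w|\<mu>. g w)" if m: "N + degree p \<le> m" and v: "cmod v = 1" for m v
  proof -
    have "quad v (Suc m) g = quad v (Suc m) (\<lambda>w. \<Sum>j\<le>degree p. coeff p j * (cnj w ^ N * w ^ j))"
      using eq by (rule quad_cong[OF v])
    also have "\<dots> = (\<Sum>j\<le>degree p. coeff p j * (LINT w|\<mu>. cnj w ^ N * w ^ j))"
      unfolding quad_sum quad_mult using m by (intro sum.cong) (auto simp: quad_monomial[OF v])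
    also have "\<dots> = (LINT w|\<mu>. (\<Sum>j\<le>degree p. coeff p j * (cnj w ^ N * w ^ j)))"
      by (subst Bochner_Integration.integral_sum)
        (auto intro!: integrable_circle continuous_intros)
    also have "\<dots> = (LINT w|\<mu>. g w)"
      using eq by (intro integral_circle_cong) simp
    finally show ?thesis .
  qed
  then show ?thesis by (rule that)
qed

lemma integral_norm_le_circle:
  fixes g :: "complex \<Rightarrow> complex"
  assumes g: "continuous_on \<T> g" and B: "\<And>w. cmod w = 1 \<Longrightarrow> cmod (g w) \<le> B"
  shows "cmod (LINT w|\<mu>. g w) \<le> B"
proof -
  have "cmod (LINT w|\<mu>. g w) \<le> (LINT w|\<mu>. cmod (g w))"
    by (rule integral_norm_bound)
  also have "\<dots> \<le> B"
    using g B by (intro integral_le_const integrable_circle continuous_intros)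
      (auto intro!: AE_I2 simp: space_circle)
  finally show ?thesis .
qed

text \<open>The quadrature measures have total mass \<open>1\<close> and are eventually exact on each
  trigonometric polynomial; these are dense in the continuous functions on the circle.\<close>

lemma quad_tendsto:
  assumes u: "\<forall>n\<ge>1. cmod (u n) = 1" and g: "continuous_on \<T> g"
  shows "(\<lambda>n. quad (u n) n g) \<longlonglongrightarrow> (LINT w|\<mu>. g w)"
proof (rule metric_LIMSEQ_I)
  fix e :: real assume "e > 0"
  then obtain h where h: "trig_polynomial h" "\<And>w. cmod w = 1 \<Longrightarrow> cmod (g w - h w) < e / 3"
    using trig_polynomial_dense[OF g, of "e / 3"] by auto
  have hc: "continuous_on \<T> h" using h(1) by (rule trig_polynomial_continuous)
  obtain M where M: "\<And>m v. M \<le> m \<Longrightarrow> cmod v = 1 \<Longrightarrow> quad v (Suc m) h = (LINT w|\<mu>. h w)"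
    using quad_trig_polynomial[OF h(1)] by blast
  have "dist (quad (u n) n g) (LINT w|\<mu>. g w) < e" if n: "n \<ge> Suc M" for n
  proof -
    obtain m where m: "n = Suc m" "M \<le> m" using n by (metis Suc_le_D Suc_le_mono)
    have v: "cmod (u n) = 1" using u n by simp
    have "quad (u n) n g - (LINT w|\<mu>. g w) =
        quad (u n) (Suc m) (\<lambda>w. g w - h w) - (LINT w|\<mu>. g w - h w)"
      unfolding quad_diff Bochner_Integration.integral_diff[OF integrable_circle[OF g] integrable_circle[OF hc]]
      using M[OF m(2) v] m(1) by simp
    moreover have "cmod (quad (u n) (Suc m) (\<lambda>w. g w - h w)) \<le> e / 3"
      using h(2) by (intro quad_norm_le[OF v]) (auto intro: less_imp_le)
    moreover have "cmod (LINT w|\<mu>. g w - h w) \<le> e / 3"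
      using h(2) by (intro integral_norm_le_circle continuous_on_diff g hc) (auto intro: less_imp_le)
    ultimately have "cmod (quad (u n) n g - (LINT w|\<mu>. g w)) \<le> e / 3 + e / 3"
      using norm_triangle_ineq4 by (smt (verit, best))
    with \<open>e > 0\<close> show ?thesis by (simp add: dist_norm)
  qed
  then show "\<exists>N. \<forall>n\<ge>N. dist (quad (u n) n g) (LINT w|\<mu>. g w) < e" by blast
qed

text \<open>The parameter \<open>z\<close> ranges over a compact set, so the functions \<open>G z\<close> are equicontinuous
  in \<open>z\<close>, and a finite net of values of \<open>z\<close> makes the convergence uniform.\<close>

lemma quad_uniform_limit:
  fixes K :: "complex set" and G :: "complex \<Rightarrow> complex \<Rightarrow> complex" and u :: "nat \<Rightarrow> complex"
  assumes u: "\<forall>n\<ge>1. cmod (u n) = 1" and K: "compact K"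
    and G: "continuous_on (K \<times> \<T>) (\<lambda>(z, w). G z w)"
  shows "uniform_limit K (\<lambda>n z. quad (u n) n (G z)) (\<lambda>z. LINT w|\<mu>. G z w) sequentially"
proof (rule uniform_limitI)
  fix e :: real assume e: "e > 0"
  have Gz: "continuous_on \<T> (G z)" if "z \<in> K" for z
  proof -
    have "continuous_on \<T> ((\<lambda>(z, w). G z w) \<circ> (\<lambda>w. (z, w)))"
      by (intro continuous_on_compose continuous_intros continuous_on_subset[OF G]) (use that in auto)
    then show ?thesis by (simp add: o_def)
  qed
  have "uniformly_continuous_on (K \<times> \<T>) (\<lambda>(z, w). G z w)"
    by (intro compact_uniformly_continuous G compact_Times K compact_sphere)
  then have "\<exists>d>0. \<forall>x\<in>K \<times> \<T>. \<forall>x'\<in>K \<times> \<T>. dist x' x < d \<longrightarrow>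
      dist (case_prod G x') (case_prod G x) < e / 4"
    unfolding uniformly_continuous_on_def by (rule allE[of _ "e / 4"]) (use e in simp)
  then obtain d where d: "d > 0" and Gd: "\<And>x x'. x \<in> K \<times> \<T> \<Longrightarrow> x' \<in> K \<times> \<T> \<Longrightarrow>
      dist x' x < d \<Longrightarrow> dist (case_prod G x') (case_prod G x) < e / 4"
    by blast
  have close: "cmod (G z w - G y w) \<le> e / 4" if "z \<in> K" "y \<in> K" "dist y z < d" "cmod w = 1" for y z w
    using Gd[of "(y, w)" "(z, w)"] that by (simp add: dist_norm dist_Pair_Pair norm_minus_commute)
  have cover: "K \<subseteq> (\<Union>y\<in>K. ball y d)" using d by auto
  obtain T where T: "T \<subseteq> K" "finite T" "K \<subseteq> (\<Union>y\<in>T. ball y d)"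
    by (rule compactE_image[OF K _ cover]) auto
  have "\<forall>\<^sub>F n in sequentially. dist (quad (u n) n (G y)) (LINT w|\<mu>. G y w) < e / 4" if "y \<in> T" for y
    using quad_tendsto[OF u Gz, of y] that T e by (intro tendstoD) auto
  then have "\<forall>\<^sub>F n in sequentially. \<forall>y\<in>T. dist (quad (u n) n (G y)) (LINT w|\<mu>. G y w) < e / 4"
    using T(2) by (simp add: eventually_ball_finite_distrib)
  then show "\<forall>\<^sub>F n in sequentially. \<forall>z\<in>K. dist (quad (u n) n (G z)) (LINT w|\<mu>. G z w) < e"
    using eventually_ge_at_top[of 1]
  proof eventually_elim
    case (elim n)
    obtain m where m: "n = Suc m" using elim by (cases n) auto
    have v: "cmod (u n) = 1" using u elim by simp
    show ?case
    proof
      fix z assume z: "z \<in> K"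
      then obtain y where y: "y \<in> T" "dist y z < d" using T(3) by auto
      then have yK: "y \<in> K" using T by auto
      have c: "cmod (G z w - G y w) \<le> e / 4" if "cmod w = 1" for w
        using close[OF z yK y(2) that] .
      let ?q = "quad (u n) (Suc m) (\<lambda>w. G z w - G y w)" and ?i = "LINT w|\<mu>. G z w - G y w"
        and ?r = "quad (u n) n (G y) - (LINT w|\<mu>. G y w)"
      have "quad (u n) n (G z) - (LINT w|\<mu>. G z w) = (?q - ?i) + ?r"
        unfolding quad_diff
          Bochner_Integration.integral_diff[OF integrable_circle[OF Gz[OF z]] integrable_circle[OF Gz[OF yK]]]
        by (simp add: m)
      then have "cmod (quad (u n) n (G z) - (LINT w|\<mu>. G z w)) \<le> cmod ?q + cmod ?i + cmod ?r"
        using norm_triangle_ineq4[of ?q ?i] norm_triangle_ineq[of "?q - ?i" ?r] by simp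
      moreover have "cmod ?q \<le> e / 4"
        using c by (rule quad_norm_le[OF v])
      moreover have "cmod ?i \<le> e / 4"
        using c by (intro integral_norm_le_circle continuous_on_diff Gz z yK)
      moreover have "cmod ?r < e / 4"
        using elim y by (simp add: dist_norm)
      ultimately have "cmod (quad (u n) n (G z) - (LINT w|\<mu>. G z w)) < e"
        using e by linarith
      then show "dist (quad (u n) n (G z)) (LINT w|\<mu>. G z w) < e" by (simp add: dist_norm)
    qed
  qed
qed

text \<open>The Caratheodory kernel is singular at \<open>w = z\<close>. Away from the support and the zeros it
  agrees with a kernel that is continuous everywhere, obtained by bounding \<open>\<bar>w - z\<bar>\<close> from
  below in the denominator.\<close>

lemma approximants_converge_if_zeros_separated:
  assumes u: "\<forall>n\<ge>1. cmod (u n) = 1" and F: "F \<le> sequentially"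
    and S: "S \<inter> measure_supp \<mu> = {}"
    and sep: "\<And>K. compact K \<Longrightarrow> K \<subseteq> S \<Longrightarrow>
      \<exists>d>0. \<forall>\<^sub>F n in F. \<forall>z\<in>K. \<forall>y\<in>para_zeros a u n. d \<le> dist z y"
  shows "approximants_converge \<mu> a u F S"
  unfolding approximants_converge_def
proof (intro conjI allI impI S)
  fix K assume "compact K \<and> K \<subseteq> S"
  then have K: "compact K" "K \<subseteq> S" by auto
  obtain d1 where d1: "d1 > 0" "\<forall>\<^sub>F n in F. \<forall>z\<in>K. \<forall>y\<in>para_zeros a u n. d1 \<le> dist z y"
    using sep[OF K] by blast
  obtain d2 where d2: "d2 > 0" "\<forall>z\<in>K. \<forall>y\<in>measure_supp \<mu>. d2 \<le> dist z y"
    using separate_compact_closed[OF K(1) closed_measure_supp] S K(2) by blast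
  define d where "d = min d1 d2"
  have d: "d > 0" using d1 d2 by (simp add: d_def)
  define G where "G z w = (w + z) * cnj (w - z) / of_real ((max (cmod (w - z)) d)\<^sup>2)" for z w
  have G_eq: "G z w = (w + z) / (w - z)" if "d \<le> dist z w" for z w
  proof -
    have wz: "w \<noteq> z" using that d by auto
    have max: "max (cmod (w - z)) d = cmod (w - z)"
      using that by (simp add: dist_norm norm_minus_commute)
    show ?thesis
      unfolding G_def max complex_norm_square using wz by (simp add: divide_simps)
  qed
  have max_nz: "max (cmod (w - z)) d \<noteq> 0" for w z
    using d max.cobounded2[of d "cmod (w - z)"] by linarith
  have "continuous_on (K \<times> \<T>) (\<lambda>(z, w). G z w)"
    unfolding G_def split_beta by (intro continuous_intros) (auto simp: max_nz)
  then have "uniform_limit K (\<lambda>n z. quad (u n) n (G z)) (\<lambda>z. LINT w|\<mu>. G z w) sequentially"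
    by (rule quad_uniform_limit[OF u K(1)])
  then have lim: "uniform_limit K (\<lambda>n z. quad (u n) n (G z)) (\<lambda>z. LINT w|\<mu>. G z w) F"
    by (rule filterlim_mono[OF _ order_refl F])
  have car: "caratheodory_fun \<mu> z = (LINT w|\<mu>. G z w)" if "z \<in> K" for z
    unfolding caratheodory_fun_def
  proof (rule integral_cong_AE)
    have G': "continuous_on \<T> (G z)"
      unfolding G_def by (intro continuous_intros) (auto simp: max_nz)
    show "G z \<in> borel_measurable \<mu>"
      using integrable_circle[OF G'] by (rule borel_measurable_integrable)
    have "(\<lambda>w. (w + z) / (w - z)) \<in> borel_measurable borel"
      by measurable
    then show "(\<lambda>w. (w + z) / (w - z)) \<in> borel_measurable \<mu>"
      by (simp add: measurable_cong_sets[OF sets_circle refl] measurable_restrict_space1)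
    show "AE w in \<mu>. (w + z) / (w - z) = G z w"
      using AE_in_measure_supp
    proof (rule AE_mp, intro AE_I2 impI)
      fix w assume "w \<in> measure_supp \<mu>"
      then have "d \<le> dist z w" using d2 that by (auto simp: d_def min_le_iff_disj)
      then show "(w + z) / (w - z) = G z w" by (simp add: G_eq)
    qed
  qed
  have ev: "\<forall>\<^sub>F n in F. (\<forall>z\<in>K. poly (Phi_para a (u n) n) z \<noteq> 0) \<and>
      (\<forall>z\<in>K. mod_approximant a (u n) n z = quad (u n) n (G z))"
    using d1(2) filter_leD[OF F eventually_ge_at_top[of 1]]
  proof eventually_elim
    case (elim n)
    obtain m where m: "n = Suc m" using elim by (cases n) auto
    have v: "cmod (u n) = 1" using u elim by simp
    have nz: "poly (Phi_para a (u n) n) z \<noteq> 0" if "z \<in> K" for z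
      using elim(1) d1(1) that by (force simp: para_zeros_def)
    moreover have "mod_approximant a (u n) n z = quad (u n) n (G z)" if "z \<in> K" for z
    proof -
      have "mod_approximant a (u n) n z = quad (u n) n (\<lambda>w. (w + z) / (w - z))"
        unfolding m quad_def
        using mod_approximant_partial_fractions[OF schur_parameter_less_1, of "u n" m z]
          quad_mass[of "u n" m] v nz[OF that] by (simp add: m)
      also have "\<dots> = quad (u n) n (G z)"
        unfolding quad_def
      proof (rule sum.cong[OF refl])
        fix l assume "l \<in> {l. poly (Phi_para a (u n) n) l = 0}"
        then have "d \<le> dist z l"
          using elim(1) that by (auto simp: para_zeros_def d_def min_le_iff_disj)
        then show "of_real (1 / cd_diag a n l) * ((l + z) / (l - z)) =
            of_real (1 / cd_diag a n l) * G z l"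
          by (simp only: G_eq)
      qed
      finally show ?thesis .
    qed
    ultimately show ?case by blast
  qed
  then show "\<forall>\<^sub>F n in F. \<forall>z\<in>K. poly (Phi_para a (u n) n) z \<noteq> 0"
    by eventually_elim simp
  have "uniform_limit K (\<lambda>n. mod_approximant a (u n) n) (caratheodory_fun \<mu>) F \<longleftrightarrow>
      uniform_limit K (\<lambda>n z. quad (u n) n (G z)) (\<lambda>z. LINT w|\<mu>. G z w) F"
    using ev by (intro uniform_limit_cong) (auto simp: car elim: eventually_mono)
  with lim show "uniform_limit K (\<lambda>n. mod_approximant a (u n) n) (caratheodory_fun \<mu>) F"
    by simp
qed

end


section \<open>Zeros outside the support\<close>

lemma not_in_upper_set_limit:
  assumes "x \<notin> upper_set_limit E"
  obtains e where "e > 0" "\<forall>\<^sub>F n in sequentially. \<forall>y\<in>E n. e \<le> dist x y"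
proof -
  let ?f = "\<lambda>n. INF y\<in>E n. ereal (dist x y)"
  have "0 \<le> liminf ?f"
    by (intro Liminf_bounded always_eventually allI INF_greatest) simp
  then have "0 < liminf ?f"
    using assms by (simp add: upper_set_limit_def less_le)
  then obtain e where e: "0 < ereal e" "ereal e < liminf ?f"
    using ereal_dense2 by blast
  have "\<forall>\<^sub>F n in sequentially. ereal e < ?f n"
    using e(2) by (rule less_LiminfD)
  then have "\<forall>\<^sub>F n in sequentially. \<forall>y\<in>E n. e \<le> dist x y"
  proof eventually_elim
    case (elim n)
    show ?case
    proof
      fix y assume "y \<in> E n"
      then have "?f n \<le> ereal (dist x y)" by (rule INF_lower)
      then show "e \<le> dist x y" using elim by (metis ereal_less_eq(3) less_imp_le order.trans)
    qed
  qed
  with e(1) show ?thesis by (intro that) auto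
qed

definition szego_phase :: "(nat \<Rightarrow> complex) \<Rightarrow> nat \<Rightarrow> complex \<Rightarrow> complex" where
  "szego_phase a n z = poly (Phi_poly a n) z / poly (star_poly (Phi_poly a n)) z"

lemma norm_star_Phi_poly:
  "cmod z = 1 \<Longrightarrow> cmod (poly (star_poly (Phi_poly a n)) z) = cmod (poly (Phi_poly a n) z)"
  by (simp add: poly_star_poly_circle norm_mult norm_power)

context szego_measure
begin

text \<open>A bump function at a point of the support has positive integral, so the quadrature
  measures cannot eventually avoid a neighbourhood of the point.\<close>

lemma measure_supp_subset_upper_set_limit:
  assumes u: "\<forall>n\<ge>1. cmod (u n) = 1"
  shows "measure_supp \<mu> \<subseteq> upper_set_limit (para_zeros a u)"
proof (rule subsetI, rule ccontr)
  fix x assume x: "x \<in> measure_supp \<mu>" and "x \<notin> upper_set_limit (para_zeros a u)"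
  then obtain e where e: "e > 0" "\<forall>\<^sub>F n in sequentially. \<forall>y\<in>para_zeros a u n. e \<le> dist x y"
    using not_in_upper_set_limit by blast
  define g where "g w = max 0 (e - dist x w)" for w
  have g: "continuous_on \<T> g"
    unfolding g_def by (intro continuous_intros)
  have cg: "continuous_on \<T> (\<lambda>w. complex_of_real (g w))"
    by (intro continuous_intros g)
  have "(\<lambda>n. quad (u n) n (\<lambda>w. of_real (g w))) \<longlonglongrightarrow> (LINT w|\<mu>. complex_of_real (g w))"
    by (rule quad_tendsto[OF u cg])
  moreover have "\<forall>\<^sub>F n in sequentially. quad (u n) n (\<lambda>w. of_real (g w)) = 0"
    using e(2)
  proof eventually_elim
    case (elim n)
    then have "\<forall>l\<in>{l. poly (Phi_para a (u n) n) l = 0}. g l = 0"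
      by (auto simp: para_zeros_def g_def)
    then show ?case by (simp add: quad_def)
  qed
  then have "(\<lambda>n. quad (u n) n (\<lambda>w. of_real (g w))) \<longlonglongrightarrow> 0"
    by (rule tendsto_eventually)
  ultimately have "(LINT w|\<mu>. complex_of_real (g w)) = 0"
    by (rule LIMSEQ_unique)
  then have "(LINT w|\<mu>. g w) = 0" by simp
  then have "AE w in \<mu>. g w = 0"
    by (subst (asm) integral_nonneg_eq_0_iff_AE[OF integrable_circle[OF g]]) (auto simp: g_def)
  then have "g x = 0" by (rule AE_zero_imp_zero_on_supp[OF g _ x])
  then show False using e(1) by (simp add: g_def)
qed

text \<open>Multiplying the kernel by \<open>1 - w cnj z\<close>, which is at least \<open>d\<close> in modulus on the
  support, gives at most \<open>2 \<bar>\<Phi>\<^sub>n z\<bar> \<bar>\<Phi>\<^sub>n w\<bar>\<close> by the Christoffel-Darboux formula; now compare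
  norms. Thus off the support \<open>\<bar>\<Phi>\<^sub>n\<bar>\<^sup>2\<close> controls the sum of all the preceding terms.\<close>

lemma cd_diag_le_off_supp:
  assumes z: "cmod z = 1" and d: "d > 0" "\<And>w. w \<in> measure_supp \<mu> \<Longrightarrow> d \<le> dist z w"
  shows "cd_diag a n z \<le> 4 * (cmod (poly (Phi_poly a n) z))\<^sup>2 / (d\<^sup>2 * szego_norm a n)"
proof -
  let ?h = "szego_norm a n" and ?P = "\<lambda>w. cmod (poly (Phi_poly a n) w)"
    and ?K = "\<lambda>w. cmod (poly (cd_poly a n z) w)"
  have h: "?h > 0" by (rule szego_norm_positive)
  have pointwise: "(?h * d)\<^sup>2 * (?K w)\<^sup>2 \<le> (2 * ?P z)\<^sup>2 * (?P w)\<^sup>2" if "w \<in> measure_supp \<mu>" for w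
  proof -
    have w: "cmod w = 1" using that measure_supp_subset by auto
    have "z * (1 - w * cnj z) = z - w"
      using circle_inverse[OF z] by (simp add: algebra_simps)
    then have "cmod (1 - w * cnj z) = dist z w"
      using z by (metis dist_norm mult_1 norm_mult)
    then have "?h * d * ?K w \<le> ?h * cmod (1 - w * cnj z) * ?K w"
      using d(2)[OF that] h by (intro mult_right_mono mult_left_mono) auto
    also have "\<dots> = cmod (of_real ?h * (1 - w * cnj z) * poly (cd_poly a n z) w)"
      using h by (simp add: norm_mult)
    also have "\<dots> \<le> 2 * ?P z * ?P w"
      unfolding christoffel_darboux(1)[OF schur_parameter_less_1]
      by (rule order_trans[OF norm_triangle_ineq4])
        (simp add: norm_mult norm_star_Phi_poly z w)
    finally have "(?h * d * ?K w)\<^sup>2 \<le> (2 * ?P z * ?P w)\<^sup>2"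
      using h d(1) by (intro power_mono) auto
    then show ?thesis by (simp only: power_mult_distrib)
  qed
  have "(?h * d)\<^sup>2 * cd_diag a n z = (LINT w|\<mu>. (?h * d)\<^sup>2 * (?K w)\<^sup>2)"
    by (simp only: integral_mult_right_zero cd_poly_norm)
  also have "\<dots> \<le> (LINT w|\<mu>. (2 * ?P z)\<^sup>2 * (?P w)\<^sup>2)"
  proof (intro integral_mono_AE integrable_circle continuous_intros)
    show "AE w in \<mu>. (?h * d)\<^sup>2 * (?K w)\<^sup>2 \<le> (2 * ?P z)\<^sup>2 * (?P w)\<^sup>2"
      using AE_in_measure_supp by (rule AE_mp) (intro AE_I2 impI pointwise)
  qed
  also have "\<dots> = (2 * ?P z)\<^sup>2 * ?h"
    using ip_Phi_self[of n] unfolding ip_self of_real_eq_iff by simp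
  finally have "?h * (d\<^sup>2 * ?h * cd_diag a n z) \<le> ?h * (4 * (?P z)\<^sup>2)"
    by (simp add: power2_eq_square mult_ac)
  then have "cd_diag a n z * (d\<^sup>2 * ?h) \<le> 4 * (?P z)\<^sup>2"
    using h by (simp add: mult_ac)
  then show ?thesis
    using h d(1) by (subst pos_le_divide_eq) auto
qed

text \<open>Since \<open>\<Phi>\<^sub>n y = y\<^sup>n cnj (\<Phi>\<^sub>n\<^sup>* y)\<close> on the circle, the difference of the two quotients has the
  Christoffel-Darboux expression \<open>(1 - z cnj y) K\<^sub>n(z, y)\<close> as its numerator. By Cauchy-Schwarz and
  the previous bound, \<open>K\<^sub>n(z, y)\<close> is at most a constant times the denominator
  \<open>\<bar>\<Phi>\<^sub>n z\<bar> \<bar>\<Phi>\<^sub>n y\<bar>\<close>, divided by the norm squared.\<close>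

lemma szego_phase_lipschitz_off_supp:
  assumes z: "cmod z = 1" "cmod y = 1" and d: "d > 0"
    and dz: "\<And>w. w \<in> measure_supp \<mu> \<Longrightarrow> d \<le> dist z w"
    and dy: "\<And>w. w \<in> measure_supp \<mu> \<Longrightarrow> d \<le> dist y w"
  shows "cmod (szego_phase a n z - szego_phase a n y) \<le> 4 / d\<^sup>2 * dist z y"
proof -
  let ?h = "szego_norm a n"
  define A S A0 S0 where "A = poly (Phi_poly a n) z" and "S = poly (star_poly (Phi_poly a n)) z"
    and "A0 = poly (Phi_poly a n) y" and "S0 = poly (star_poly (Phi_poly a n)) y"
  note defs = A_def S_def A0_def S0_def
  have h: "?h > 0" by (rule szego_norm_positive)
  have A: "A \<noteq> 0" "A0 \<noteq> 0" "cmod S = cmod A" "cmod S0 = cmod A0"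
    unfolding defs using z by (simp_all add: Phi_poly_circle_nonzero[OF schur_parameter_less_1] norm_star_Phi_poly)
  then have S: "S \<noteq> 0" "S0 \<noteq> 0" by auto
  have yy: "y ^ n * cnj y ^ n = 1"
    using circle_inverse[OF z(2)] by (metis power_mult_distrib power_one)
  have S0: "S0 = y ^ n * cnj A0"
    unfolding defs by (simp add: poly_star_poly_circle[OF z(2)])
  then have A0: "A0 = y ^ n * cnj S0"
    using yy by (simp add: mult.assoc[symmetric])
  have "szego_phase a n z - szego_phase a n y = (A * S0 - A0 * S) / (S * S0)"
    unfolding szego_phase_def defs[symmetric] using S by (simp add: diff_frac_eq mult.commute)
  also have "A * S0 - A0 * S = - (y ^ n * (S * cnj S0 - A * cnj A0))"
    by (subst S0, subst A0) (simp add: algebra_simps)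
  also have "S * cnj S0 - A * cnj A0 = of_real ?h * (1 - z * cnj y) * poly (cd_poly a n y) z"
    unfolding defs by (rule christoffel_darboux(1)[OF schur_parameter_less_1, symmetric])
  finally have eq: "cmod (szego_phase a n z - szego_phase a n y) =
      ?h * cmod (1 - z * cnj y) * cmod (poly (cd_poly a n y) z) / (cmod A * cmod A0)"
    using h A z by (simp add: norm_divide norm_mult norm_power)
  have "y * (1 - z * cnj y) = y - z"
    using circle_inverse[OF z(2)] by (simp add: algebra_simps)
  then have dist: "cmod (1 - z * cnj y) = dist z y"
    using z by (metis dist_norm mult_1 norm_mult norm_minus_commute)
  have "(cmod (poly (cd_poly a n y) z))\<^sup>2 \<le> cd_diag a n z * cd_diag a n y"
    by (rule cd_poly_cauchy_schwarz[OF schur_parameter_less_1])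
  also have "\<dots> \<le> (4 * (cmod A)\<^sup>2 / (d\<^sup>2 * ?h)) * (4 * (cmod A0)\<^sup>2 / (d\<^sup>2 * ?h))"
    unfolding defs using z d dz dy h szego_norm_positive
    by (intro mult_mono cd_diag_le_off_supp)
      (auto simp: cd_diag_def less_imp_le intro!: sum_nonneg divide_nonneg_nonneg)
  also have "\<dots> = (4 * cmod A * cmod A0 / (d\<^sup>2 * ?h))\<^sup>2"
    by (simp add: power2_eq_square)
  finally have "cmod (poly (cd_poly a n y) z) \<le> 4 * cmod A * cmod A0 / (d\<^sup>2 * ?h)"
    using h by (intro power2_le_imp_le[of "cmod (poly (cd_poly a n y) z)"]) auto
  then have "?h * dist z y * cmod (poly (cd_poly a n y) z) / (cmod A * cmod A0) \<le>
      ?h * dist z y * (4 * cmod A * cmod A0 / (d\<^sup>2 * ?h)) / (cmod A * cmod A0)"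
    using h by (intro divide_right_mono mult_left_mono) auto
  also have "\<dots> = 4 / d\<^sup>2 * dist z y"
    using h A d by (simp add: field_simps)
  finally show ?thesis unfolding eq dist .
qed

lemma szego_phase_norm: "cmod z = 1 \<Longrightarrow> cmod (szego_phase a n z) = 1"
  using Phi_poly_circle_nonzero[OF schur_parameter_less_1, of z n]
  by (simp add: szego_phase_def norm_divide norm_star_Phi_poly)

text \<open>The phase \<open>\<Phi>\<^sub>n / \<Phi>\<^sub>n\<^sup>*\<close> is a Moebius function of \<open>z \<Phi>\<^sub>n\<^sub>-\<^sub>1 / \<Phi>\<^sub>n\<^sub>-\<^sub>1\<^sup>*\<close>, which equals \<open>- v\<close>
  at all the zeros of the para-orthogonal polynomial of degree \<open>n\<close>.\<close>

lemma szego_phase_at_zero: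
  assumes v: "cmod v = 1" and l: "poly (Phi_para a v (Suc m)) l = 0"
  shows "szego_phase a (Suc m) l = (a (Suc m) - v) / (1 - cnj (a (Suc m)) * v)"
proof -
  let ?S = "poly (star_poly (Phi_poly a m)) l"
  have l1: "cmod l = 1" by (rule Phi_para_zero_on_circle[OF schur_parameter_less_1 v l])
  then have "poly (Phi_poly a m) l \<noteq> 0"
    by (rule Phi_poly_circle_nonzero[OF schur_parameter_less_1])
  then have S: "?S \<noteq> 0" using norm_star_Phi_poly[OF l1, of a m] by auto
  have "l * poly (Phi_poly a m) l = - v * ?S"
    using l by (simp add: Phi_para_zero_iff)
  then have "poly (Phi_poly a (Suc m)) l = (a (Suc m) - v) * ?S"
    "poly (star_poly (Phi_poly a (Suc m))) l = (1 - cnj (a (Suc m)) * v) * ?S"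
    unfolding poly_Phi_poly_Suc poly_star_Phi_poly_Suc by (simp_all add: algebra_simps)
  then show ?thesis using S by (simp add: szego_phase_def)
qed

lemma szego_phase_at_next_zero:
  assumes v: "cmod v = 1" and l: "poly (Phi_para a v (Suc n)) l = 0"
  shows "l * szego_phase a n l = - v"
proof -
  have l1: "cmod l = 1" by (rule Phi_para_zero_on_circle[OF schur_parameter_less_1 v l])
  then have "poly (Phi_poly a n) l \<noteq> 0"
    by (rule Phi_poly_circle_nonzero[OF schur_parameter_less_1])
  then have "poly (star_poly (Phi_poly a n)) l \<noteq> 0"
    using norm_star_Phi_poly[OF l1, of a n] by auto
  then show ?thesis
    using l by (simp add: szego_phase_def Phi_para_zero_iff)
qed

text \<open>Suppose that zeros \<open>l1\<close>, \<open>l2\<close> of degree \<open>n\<close> and \<open>l1'\<close>, \<open>l2'\<close> of degree \<open>n + 1\<close> lie within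
  \<open>r\<close> of \<open>z1\<close>, \<open>z2\<close>. The phase \<open>c\<close> of index \<open>n\<close> satisfies \<open>c l1 = c l2\<close> and
  \<open>l1' * c l1' = l2' * c l2'\<close>. It is Lipschitz near both points, so its four values nearly
  agree; hence \<open>l1'\<close> and \<open>l2'\<close> nearly agree.\<close>

lemma zero_limit_off_supp_unique:
  assumes u: "\<forall>n\<ge>1. cmod (u n) = 1"
    and z1: "z1 \<notin> measure_supp \<mu>" "\<forall>e>0. \<forall>\<^sub>F n in sequentially. \<exists>y\<in>para_zeros a u n. dist z1 y < e"
    and z2: "z2 \<notin> measure_supp \<mu>" "\<forall>e>0. \<forall>\<^sub>F n in sequentially. \<exists>y\<in>para_zeros a u n. dist z2 y < e"
  shows "z1 = z2"
proof (rule ccontr)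
  assume "z1 \<noteq> z2"
  obtain d1 where d1: "d1 > 0" "\<forall>x\<in>{z1, z2}. \<forall>w\<in>measure_supp \<mu>. d1 \<le> dist x w"
    using separate_compact_closed[of "{z1, z2}" "measure_supp \<mu>"] closed_measure_supp z1(1) z2(1) by auto
  \<comment> \<open>Points within \<open>r \<le> d\<close> of \<open>z1\<close> or \<open>z2\<close> keep the distance \<open>d\<close> from the support. The triangle
    inequalities below add up to \<open>(4 C + 2) r\<close>; the constant in \<open>r\<close> exceeds it strictly.\<close>
  define d where "d = d1 / 2"
  define C where "C = 4 / d\<^sup>2"
  define r where "r = min d (dist z1 z2 / (4 * C + 3))"
  have d: "d > 0" and C: "C > 0" using d1 by (simp_all add: d_def C_def)
  have r: "r > 0" "r \<le> d"
    using d C \<open>z1 \<noteq> z2\<close> by (simp_all add: r_def)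
  have "r \<le> dist z1 z2 / (4 * C + 3)" by (simp add: r_def)
  then have rC: "(4 * C + 3) * r \<le> dist z1 z2"
    using C by (simp add: pos_le_divide_eq mult.commute)
  have "\<forall>\<^sub>F n in sequentially. (\<exists>y\<in>para_zeros a u n. dist z1 y < r) \<and> (\<exists>y\<in>para_zeros a u n. dist z2 y < r)"
    using z1(2) z2(2) r(1) by (intro eventually_conj) auto
  then obtain N where N: "\<And>n. n \<ge> N \<Longrightarrow> (\<exists>y\<in>para_zeros a u n. dist z1 y < r) \<and> (\<exists>y\<in>para_zeros a u n. dist z2 y < r)"
    unfolding eventually_sequentially by blast
  obtain l1 l2 where l: "l1 \<in> para_zeros a u (Suc N)" "dist z1 l1 < r" "l2 \<in> para_zeros a u (Suc N)" "dist z2 l2 < r"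
    using N[of "Suc N"] by auto
  obtain l1' l2' where l': "l1' \<in> para_zeros a u (Suc (Suc N))" "dist z1 l1' < r"
      "l2' \<in> para_zeros a u (Suc (Suc N))" "dist z2 l2' < r"
    using N[of "Suc (Suc N)"] by auto
  let ?v = "u (Suc N)" and ?v' = "u (Suc (Suc N))" and ?c = "szego_phase a (Suc N)"
  have v: "cmod ?v = 1" "cmod ?v' = 1" using u by auto
  have circ: "cmod l1 = 1" "cmod l2 = 1" "cmod l1' = 1" "cmod l2' = 1"
    using l l' Phi_para_zero_on_circle[OF schur_parameter_less_1] v by (auto simp: para_zeros_def)
  have off: "d \<le> dist y w" if "x \<in> {z1, z2}" "dist x y < r" "w \<in> measure_supp \<mu>" for x y w
  proof -
    have "d1 \<le> dist x w" using d1(2) that by blast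
    then show ?thesis
      using dist_triangle[of x w y] that(2) r(2) by (simp add: d_def)
  qed
  have near: "cmod (?c y' - ?c y) \<le> C * (2 * r)"
    if "x \<in> {z1, z2}" "dist x y < r" "dist x y' < r" "cmod y = 1" "cmod y' = 1" for x y y'
  proof -
    have "cmod (?c y' - ?c y) \<le> C * dist y' y"
      unfolding C_def using that d off by (intro szego_phase_lipschitz_off_supp) blast+
    also have "\<dots> \<le> C * (2 * r)"
      using C that(2,3) dist_triangle2[of y' y x] by (intro mult_left_mono) (auto simp: dist_commute)
    finally show ?thesis .
  qed
  have c: "?c l1 = ?c l2"
    using l v by (simp add: para_zeros_def szego_phase_at_zero)
  have "l1' * ?c l1' = l2' * ?c l2'"
    using l' v by (simp add: para_zeros_def szego_phase_at_next_zero)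
  then have "(l1' - l2') * ?c l1 = l2' * (?c l2' - ?c l2) - l1' * (?c l1' - ?c l1)"
    using c by (simp add: algebra_simps)
  then have "cmod ((l1' - l2') * ?c l1) \<le> cmod (l2' * (?c l2' - ?c l2)) + cmod (l1' * (?c l1' - ?c l1))"
    by (simp only: norm_triangle_ineq4)
  then have "dist l1' l2' \<le> cmod (?c l2' - ?c l2) + cmod (?c l1' - ?c l1)"
    by (simp add: norm_mult circ szego_phase_norm dist_norm)
  also have "\<dots> \<le> C * (2 * r) + C * (2 * r)"
    using l l' circ by (intro add_mono near[of z2] near[of z1]) auto
  finally have "dist l1' l2' \<le> 4 * C * r" by simp
  moreover have "dist z1 z2 \<le> dist z1 l1' + dist l1' l2' + dist z2 l2'"
    using dist_triangle[of z1 z2 l1'] dist_triangle[of l1' z2 l2'] by (simp add: dist_commute)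
  ultimately have "dist z1 z2 < (4 * C + 3) * r"
    using l' r(1) by (simp add: distrib_right)
  with rC show False by simp
qed

end


section \<open>Convergence of the modified approximants\<close>

lemma compact_separated_from_sets:
  fixes E :: "nat \<Rightarrow> 'a::metric_space set"
  assumes K: "compact K"
    and sep: "\<And>x. x \<in> K \<Longrightarrow> \<exists>e>0. \<forall>\<^sub>F n in F. \<forall>y\<in>E n. e \<le> dist x y"
  shows "\<exists>d>0. \<forall>\<^sub>F n in F. \<forall>x\<in>K. \<forall>y\<in>E n. d \<le> dist x y"
proof -
  obtain e where e: "\<And>x. x \<in> K \<Longrightarrow> e x > 0 \<and> (\<forall>\<^sub>F n in F. \<forall>y\<in>E n. e x \<le> dist x y)"
    using sep by metis
  have cover: "K \<subseteq> (\<Union>x\<in>K. ball x (e x / 2))" using e by force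
  obtain T where T: "T \<subseteq> K" "finite T" "K \<subseteq> (\<Union>x\<in>T. ball x (e x / 2))"
    by (rule compactE_image[OF K _ cover]) auto
  define d where "d = Min (insert 1 ((\<lambda>x. e x / 2) ` T))"
  have "d > 0"
    using T e by (auto simp: d_def)
  moreover have "d \<le> e x / 2" if "x \<in> T" for x
    unfolding d_def using T(2) that by (intro Min_le) auto
  ultimately have d: "d > 0" "\<And>x. x \<in> T \<Longrightarrow> d \<le> e x / 2" by auto
  have "\<forall>\<^sub>F n in F. \<forall>x\<in>T. \<forall>y\<in>E n. e x \<le> dist x y"
    using e T by (intro eventually_ball_finite) auto
  then have "\<forall>\<^sub>F n in F. \<forall>x\<in>K. \<forall>y\<in>E n. d \<le> dist x y"
  proof eventually_elim
    case (elim n)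
    show ?case
    proof (intro ballI)
      fix x y assume "x \<in> K" "y \<in> E n"
      then obtain t where t: "t \<in> T" "dist t x < e t / 2" using T(3) by auto
      then have "e t \<le> dist t y" using elim \<open>y \<in> E n\<close> by blast
      then show "d \<le> dist x y"
        using t d(2)[of t] dist_triangle[of t y x] by linarith
    qed
  qed
  with d(1) show ?thesis by blast
qed

theorem corollary5p3:
  fixes \<mu> :: "complex measure" and a u :: "nat \<Rightarrow> complex"
  assumes "prob_space \<mu>"
    and "sets \<mu> = sets (restrict_space borel \<T>)"
    and "infinite (measure_supp \<mu>)"
    and "schur_parameters \<mu> a"
    and "\<forall>n\<ge>1. u n \<in> \<T>"
  shows "approximants_converge \<mu> a u sequentially (- upper_set_limit (para_zeros a u)) \<and>
    (\<exists>p. \<forall>z \<in> upper_set_limit (para_zeros a u) - measure_supp \<mu> - {p}.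
       \<exists>V. open V \<and> z \<in> V \<and>
         (\<exists>I :: nat set. infinite I \<and>
            approximants_converge \<mu> a u (inf sequentially (principal I)) V))"
proof
  interpret szego_measure \<mu> a
    using assms by (intro szego_measure.intro circle_measure.intro circle_measure_axioms.intro
        szego_measure_axioms.intro)
  let ?E = "para_zeros a u" and ?S = "measure_supp \<mu>"
  have u: "\<forall>n\<ge>1. cmod (u n) = 1"
    using assms(5) by simp
  show "approximants_converge \<mu> a u sequentially (- upper_set_limit ?E)"
  proof (rule approximants_converge_if_zeros_separated[OF u order_refl])
    show "- upper_set_limit ?E \<inter> ?S = {}"
      using measure_supp_subset_upper_set_limit[OF u] by blast
    fix K assume K: "compact K" "K \<subseteq> - upper_set_limit ?E"
    show "\<exists>d>0. \<forall>\<^sub>F n in sequentially. \<forall>z\<in>K. \<forall>y\<in>?E n. d \<le> dist z y"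
    proof (rule compact_separated_from_sets[OF K(1)])
      fix x assume "x \<in> K"
      then have "x \<notin> upper_set_limit ?E" using K(2) by blast
      then show "\<exists>e>0. \<forall>\<^sub>F n in sequentially. \<forall>y\<in>?E n. e \<le> dist x y"
        by (rule not_in_upper_set_limit) blast
    qed
  qed
  \<comment> \<open>The exceptional point is the one point off the support, if there is any, that attracts
    zeros along the whole sequence of indices.\<close>
  define X where "X = {z. z \<notin> ?S \<and> (\<forall>e>0. \<forall>\<^sub>F n in sequentially. \<exists>y\<in>?E n. dist z y < e)}"
  have "\<exists>p. X \<subseteq> {p}"
  proof (cases "X = {}")
    case False
    then obtain p where "p \<in> X" by blast
    then have "X \<subseteq> {p}"
      using zero_limit_off_supp_unique[OF u] unfolding X_def by blast
    then show ?thesis by blast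
  qed simp
  then obtain p where p: "X \<subseteq> {p}" by blast
  have "\<exists>V. open V \<and> z \<in> V \<and> (\<exists>I. infinite I \<and>
      approximants_converge \<mu> a u (inf sequentially (principal I)) V)"
    if z: "z \<in> upper_set_limit ?E - ?S - {p}" for z
  proof -
    have "z \<notin> X" "z \<notin> ?S" using p z by auto
    then obtain e where e: "e > 0" "\<not> (\<forall>\<^sub>F n in sequentially. \<exists>y\<in>?E n. dist z y < e)"
      unfolding X_def by blast
    define I where "I = {n. \<not> (\<exists>y\<in>?E n. dist z y < e)}"
    have "\<exists>\<^sub>F n in sequentially. n \<in> I"
      using e(2) by (simp add: frequently_def I_def)
    then have "infinite I"
      by (simp add: cofinite_eq_sequentially[symmetric] frequently_cofinite)
    define V where "V = ball z (e / 2) - ?S"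
    have "open V" "z \<in> V"
      using closed_measure_supp \<open>z \<notin> ?S\<close> e(1) by (auto simp: V_def)
    have "approximants_converge \<mu> a u (inf sequentially (principal I)) V"
    proof (rule approximants_converge_if_zeros_separated[OF u inf_le1])
      show "V \<inter> ?S = {}" by (auto simp: V_def)
      fix K assume "compact K" "K \<subseteq> V"
      have "e / 2 \<le> dist x y" if "n \<in> I" "x \<in> K" "y \<in> ?E n" for n x y
      proof -
        have "e \<le> dist z y" using that by (auto simp: I_def not_less)
        moreover have "dist z x < e / 2" using \<open>K \<subseteq> V\<close> that by (auto simp: V_def)
        ultimately show ?thesis using dist_triangle[of z y x] by simp
      qed
      then have "\<forall>\<^sub>F n in inf sequentially (principal I). \<forall>x\<in>K. \<forall>y\<in>?E n. e / 2 \<le> dist x y"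
        by (auto simp: eventually_inf_principal)
      then show "\<exists>d>0. \<forall>\<^sub>F n in inf sequentially (principal I). \<forall>x\<in>K. \<forall>y\<in>?E n. d \<le> dist x y"
        using e(1) by (intro exI[of _ "e / 2"]) simp
    qed
    with \<open>open V\<close> \<open>z \<in> V\<close> \<open>infinite I\<close> show ?thesis by blast
  qed
  then show "\<exists>p. \<forall>z \<in> upper_set_limit ?E - ?S - {p}. \<exists>V. open V \<and> z \<in> V \<and> (\<exists>I. infinite I \<and>
      approximants_converge \<mu> a u (inf sequentially (principal I)) V)"
    by blast
qed

end
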